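(* Let $m_1>n_1$, $m_2>n_2$, and let $B_1=(\phi_j(t_i))_{1\le i\le m_1,1\le j\le n_1}$ and $B_2=(\psi_j(s_i))_{1\le i\le m_2,1\le j\le n_2}$ be the collocation matrices of the NTP bases $\{\phi_i\}_{i=1}^{n_1}$ and $\{\psi_j\}_{j=1}^{n_2}$. Suppose $\operatorname{rank}(B_1)=r$, $\operatorname{rank}(B_2)=s$, and let $\sigma_1\ge\cdots\ge\sigma_r>0$ and $\mu_1\ge\cdots\ge\mu_s>0$ be the (nonzero) singular values of $B_1$ and $B_2$, respectively. Then: 1) If the real weights $\omega,\gamma,\upsilon$ satisfy $$\upsilon>0,\qquad 0<\omega<2,\qquad \omega-\frac{\omega}{(\sigma_1\mu_1)^2\upsilon}<\gamma<\frac{\omega}{2}-\frac{\omega-2}{(\sigma_1\mu_1)^2\upsilon},$$ then for any initial control point set $\{P_{ij}^0\}_{i=1,j=1}^{n_1,n_2}$ and any point set $\{\Lambda_{ij}^0\}_{i=1,j=1}^{m_1,m_2}$ in $\mathbb{R}^d$, the sequence of surfaces generated by the MLSPIA method for surfaces with weights $\omega,\gamma,\upsilon$ converges to a least square fitting surface of $\{Q_{ij}\}_{i=1,j=1}^{m_1,m_2}$. 2) Let $$\omega^*=\gamma^*=\frac{4\sigma_1\mu_1\sigma_r\mu_s}{(\sigma_1\mu_1+\sigma_r\mu_s)^2},\qquad \upsilon^*=\frac{1}{\sigma_1\mu_1\sigma_r\mu_s}.$$ The convergence rate of the MLSPIA method for tensor product surfaces at the weights $\omega=\omega^*,\gamma=\gamma^*,\upsilon=\upsilon^*$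 is $$\rho(\hat H_{\omega^*,\gamma^*,\upsilon^*})=\frac{\sigma_1\mu_1-\sigma_r\mu_s}{\sigma_1\mu_1+\sigma_r\mu_s}\le\frac{(\sigma_1\mu_1)^2-(\sigma_r\mu_s)^2}{(\sigma_1\mu_1)^2+(\sigma_r\mu_s)^2}<1 .$$
   Context: Data: points $Q_{ij}\in\mathbb{R}^d$ ($1\le i\le m_1$, $1\le j\le m_2$), parameters $0\le t_1<\cdots<t_{m_1}\le1$ and $0\le s_1<\cdots<s_{m_2}\le1$. $\{\phi_i\}_{i=1}^{n_1}$, $\{\psi_j\}_{j=1}^{n_2}$ are normalized totally positive (NTP) bases of vector spaces of real functions on $[0,1]$: bases consisting of nonnegative functions summing to $1$ on $[0,1]$, all of whose collocation matrices at increasing sequences are totally positive (all minors nonnegative). MLSPIA method for surfaces with real weights $\omega,\gamma,\upsilon$: given $P_{ij}^0$ and $\Lambda_{hl}^0$ in $\mathbb{R}^d$, for $k\ge0$, $1\le i\le n_1$, $1\le j\le n_2$, $$C^k(t,s)=\sum_{i=1}^{n_1}\sum_{j=1}^{n_2}\phi_i(t)\psi_j(s)P_{ij}^k,\qquad P_{ij}^{k+1}=P_{ij}^k+\Delta_{ij}^k,$$ $$\delta_{ij}^k=\upsilon\sum_{h=1}^{m_1}\sum_{l=1}^{m_2}\phi_i(t_h)\psi_j(s_l)\bigl(Q_{hl}-C^k(t_h,s_l)\bigr),$$ $\Delta_{ij}^0=\upsilon\sum_{h=1}^{m_1}\sum_{l=1}^{m_2}\phi_i(t_h)\psi_j(s_l)\Lambda_{hl}^0$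 and, for $k\ge1$, $\Delta_{ij}^k=(1-\omega)\Delta_{ij}^{k-1}+\gamma\delta_{ij}^k+(\omega-\gamma)\delta_{ij}^{k-1}$. A least square fitting surface is a surface $\sum_{i,j}\phi_i(t)\psi_j(s)P_{ij}$ whose control points minimize $\sum_{h,l}\|Q_{hl}-\sum_{i,j}\phi_i(t_h)\psi_j(s_l)P_{ij}\|^2$. Convergence of the surfaces means that the control points $(P_{ij}^k)_{i,j}$ converge as $k\to\infty$ to a family $(P_{ij})_{i,j}$ of such minimizing control points. Convergence rate: put $M=m_1m_2$, $R=rs$, and let $\Sigma$ be the $R\times R$ diagonal matrix whose diagonal entries are the nonzero singular values $\sigma_i\mu_j$ ($1\le i\le r$, $1\le j\le s$) of $B_1\otimes B_2$, in decreasing order. Then $$\hat H_{\omega,\gamma,\upsilon}=\begin{pmatrix}(1-\omega)I_R-\gamma\upsilon\Sigma^2&0&-\omega\Sigma\\0&(1-\omega)I_{M-R}&0\\ \upsilon\Sigma&0&I_R\end{pmatrix},$$ and the convergence rate of the method at given weights is measured by the spectral radius $\rho(\hat H_{\omega,\gamma,\upsilon})$ (smaller is faster). *)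

theory Defs
  imports
    "HOL-Analysis.Analysis"
    "Jordan_Normal_Form.DL_Submatrix"
    "Jordan_Normal_Form.DL_Rank"
    "Jordan_Normal_Form.Spectral_Radius"
begin

text \<open>
  Points, basis functions, parameters and singular values are indexed from 1. The matrices of
  \<^theory>\<open>Jordan_Normal_Form.Matrix\<close> are indexed from 0, hence the index shifts below.
  Points of \<open>d\<close>-dimensional space are elements of \<open>real ^ 'd\<close>. Several names (\<open>mat\<close>, \<open>det\<close>)
  also exist in \<open>HOL-Analysis\<close>, hence the qualified names.
\<close>

definition collocation_mat ::
  "(nat \<Rightarrow> real \<Rightarrow> real) \<Rightarrow> nat \<Rightarrow> (nat \<Rightarrow> real) \<Rightarrow> nat \<Rightarrow> real mat" where
  "collocation_mat \<phi> n t m = Matrix.mat m n (\<lambda>(i, j). \<phi> (Suc j) (t (Suc i)))"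

definition increasing_params :: "nat \<Rightarrow> (nat \<Rightarrow> real) \<Rightarrow> bool" where
  "increasing_params m t \<longleftrightarrow> strict_mono_on {1..m} t \<and> t ` {1..m} \<subseteq> {0..1}"

definition totally_positive :: "real mat \<Rightarrow> bool" where
  "totally_positive A \<longleftrightarrow>
     (\<forall>I J. I \<subseteq> {..<dim_row A} \<longrightarrow> J \<subseteq> {..<dim_col A} \<longrightarrow> card I = card J \<longrightarrow>
        0 \<le> Determinant.det (submatrix A I J))"

text \<open>
  The first conjunct is linear independence on \<open>[0,1]\<close>: \<open>\<phi> 1, \<dots>, \<phi> n\<close>
  is a basis of the space of functions on \<open>[0,1]\<close> that it spans.
\<close>

definition NTP_basis :: "nat \<Rightarrow> (nat \<Rightarrow> real \<Rightarrow> real) \<Rightarrow> bool" where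
  "NTP_basis n \<phi> \<longleftrightarrow>
     (\<forall>c. (\<forall>x\<in>{0..1}. (\<Sum>i=1..n. c i * \<phi> i x) = 0) \<longrightarrow> (\<forall>i\<in>{1..n}. c i = 0)) \<and>
     (\<forall>i\<in>{1..n}. \<forall>x\<in>{0..1}. 0 \<le> \<phi> i x) \<and>
     (\<forall>x\<in>{0..1}. (\<Sum>i=1..n. \<phi> i x) = 1) \<and>
     (\<forall>m t. increasing_params m t \<longrightarrow> totally_positive (collocation_mat \<phi> n t m))"

definition surface ::
  "nat \<Rightarrow> (nat \<Rightarrow> real \<Rightarrow> real) \<Rightarrow> nat \<Rightarrow> (nat \<Rightarrow> real \<Rightarrow> real) \<Rightarrow>
   (nat \<Rightarrow> nat \<Rightarrow> real ^ 'd) \<Rightarrow> real \<Rightarrow> real \<Rightarrow> real ^ 'd" where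
  "surface n1 \<phi> n2 \<psi> P x y = (\<Sum>i=1..n1. \<Sum>j=1..n2. (\<phi> i x * \<psi> j y) *\<^sub>R P i j)"

definition fitting_error ::
  "nat \<Rightarrow> (nat \<Rightarrow> real \<Rightarrow> real) \<Rightarrow> nat \<Rightarrow> (nat \<Rightarrow> real \<Rightarrow> real) \<Rightarrow>
   nat \<Rightarrow> (nat \<Rightarrow> real) \<Rightarrow> nat \<Rightarrow> (nat \<Rightarrow> real) \<Rightarrow>
   (nat \<Rightarrow> nat \<Rightarrow> real ^ 'd) \<Rightarrow> (nat \<Rightarrow> nat \<Rightarrow> real ^ 'd) \<Rightarrow> real" where
  "fitting_error n1 \<phi> n2 \<psi> m1 t m2 s Q P =
     (\<Sum>h=1..m1. \<Sum>l=1..m2. (norm (Q h l - surface n1 \<phi> n2 \<psi> P (t h) (s l)))\<^sup>2)"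

definition least_square_control_points ::
  "nat \<Rightarrow> (nat \<Rightarrow> real \<Rightarrow> real) \<Rightarrow> nat \<Rightarrow> (nat \<Rightarrow> real \<Rightarrow> real) \<Rightarrow>
   nat \<Rightarrow> (nat \<Rightarrow> real) \<Rightarrow> nat \<Rightarrow> (nat \<Rightarrow> real) \<Rightarrow>
   (nat \<Rightarrow> nat \<Rightarrow> real ^ 'd) \<Rightarrow> (nat \<Rightarrow> nat \<Rightarrow> real ^ 'd) \<Rightarrow> bool" where
  "least_square_control_points n1 \<phi> n2 \<psi> m1 t m2 s Q P \<longleftrightarrow>
     (\<forall>P'. fitting_error n1 \<phi> n2 \<psi> m1 t m2 s Q P \<le> fitting_error n1 \<phi> n2 \<psi> m1 t m2 s Q P')"

text \<open>
  With \<open>X h l = Q h l - C\<^sup>k (t h) (s l)\<close> the following is \<open>\<delta>\<^sup>k\<close>, and with \<open>X = \<Lambda>\<close> it is \<open>\<Delta>\<^sup>0\<close>.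
\<close>

definition weighted_sum ::
  "(nat \<Rightarrow> real \<Rightarrow> real) \<Rightarrow> (nat \<Rightarrow> real \<Rightarrow> real) \<Rightarrow>
   nat \<Rightarrow> (nat \<Rightarrow> real) \<Rightarrow> nat \<Rightarrow> (nat \<Rightarrow> real) \<Rightarrow>
   real \<Rightarrow> (nat \<Rightarrow> nat \<Rightarrow> real ^ 'd) \<Rightarrow> nat \<Rightarrow> nat \<Rightarrow> real ^ 'd" where
  "weighted_sum \<phi> \<psi> m1 t m2 s \<upsilon> X i j =
     \<upsilon> *\<^sub>R (\<Sum>h=1..m1. \<Sum>l=1..m2. (\<phi> i (t h) * \<psi> j (s l)) *\<^sub>R X h l)"

definition mlspia_delta ::
  "nat \<Rightarrow> (nat \<Rightarrow> real \<Rightarrow> real) \<Rightarrow> nat \<Rightarrow> (nat \<Rightarrow> real \<Rightarrow> real) \<Rightarrow>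
   nat \<Rightarrow> (nat \<Rightarrow> real) \<Rightarrow> nat \<Rightarrow> (nat \<Rightarrow> real) \<Rightarrow> (nat \<Rightarrow> nat \<Rightarrow> real ^ 'd) \<Rightarrow>
   real \<Rightarrow> (nat \<Rightarrow> nat \<Rightarrow> real ^ 'd) \<Rightarrow> nat \<Rightarrow> nat \<Rightarrow> real ^ 'd" where
  "mlspia_delta n1 \<phi> n2 \<psi> m1 t m2 s Q \<upsilon> P =
     weighted_sum \<phi> \<psi> m1 t m2 s \<upsilon> (\<lambda>h l. Q h l - surface n1 \<phi> n2 \<psi> P (t h) (s l))"

text \<open>\<open>mlspia k\<close> is the pair \<open>(P\<^sup>k, \<Delta>\<^sup>k)\<close>.\<close>

primrec mlspia ::
  "nat \<Rightarrow> (nat \<Rightarrow> real \<Rightarrow> real) \<Rightarrow> nat \<Rightarrow> (nat \<Rightarrow> real \<Rightarrow> real) \<Rightarrow>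
   nat \<Rightarrow> (nat \<Rightarrow> real) \<Rightarrow> nat \<Rightarrow> (nat \<Rightarrow> real) \<Rightarrow> (nat \<Rightarrow> nat \<Rightarrow> real ^ 'd) \<Rightarrow>
   real \<Rightarrow> real \<Rightarrow> real \<Rightarrow> (nat \<Rightarrow> nat \<Rightarrow> real ^ 'd) \<Rightarrow> (nat \<Rightarrow> nat \<Rightarrow> real ^ 'd) \<Rightarrow>
   nat \<Rightarrow> (nat \<Rightarrow> nat \<Rightarrow> real ^ 'd) \<times> (nat \<Rightarrow> nat \<Rightarrow> real ^ 'd)" where
  "mlspia n1 \<phi> n2 \<psi> m1 t m2 s Q \<omega> \<gamma> \<upsilon> P0 \<Lambda> 0 = (P0, weighted_sum \<phi> \<psi> m1 t m2 s \<upsilon> \<Lambda>)"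
| "mlspia n1 \<phi> n2 \<psi> m1 t m2 s Q \<omega> \<gamma> \<upsilon> P0 \<Lambda> (Suc k) =
     (let (P, \<Delta>) = mlspia n1 \<phi> n2 \<psi> m1 t m2 s Q \<omega> \<gamma> \<upsilon> P0 \<Lambda> k;
          P' = (\<lambda>i j. P i j + \<Delta> i j);
          \<delta> = mlspia_delta n1 \<phi> n2 \<psi> m1 t m2 s Q \<upsilon> P;
          \<delta>' = mlspia_delta n1 \<phi> n2 \<psi> m1 t m2 s Q \<upsilon> P'
      in (P', \<lambda>i j. (1 - \<omega>) *\<^sub>R \<Delta> i j + \<gamma> *\<^sub>R \<delta>' i j + (\<omega> - \<gamma>) *\<^sub>R \<delta> i j))"

definition mlspia_points ::
  "nat \<Rightarrow> (nat \<Rightarrow> real \<Rightarrow> real) \<Rightarrow> nat \<Rightarrow> (nat \<Rightarrow> real \<Rightarrow> real) \<Rightarrow>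
   nat \<Rightarrow> (nat \<Rightarrow> real) \<Rightarrow> nat \<Rightarrow> (nat \<Rightarrow> real) \<Rightarrow> (nat \<Rightarrow> nat \<Rightarrow> real ^ 'd) \<Rightarrow>
   real \<Rightarrow> real \<Rightarrow> real \<Rightarrow> (nat \<Rightarrow> nat \<Rightarrow> real ^ 'd) \<Rightarrow> (nat \<Rightarrow> nat \<Rightarrow> real ^ 'd) \<Rightarrow>
   nat \<Rightarrow> nat \<Rightarrow> nat \<Rightarrow> real ^ 'd" where
  "mlspia_points n1 \<phi> n2 \<psi> m1 t m2 s Q \<omega> \<gamma> \<upsilon> P0 \<Lambda> k =
     fst (mlspia n1 \<phi> n2 \<psi> m1 t m2 s Q \<omega> \<gamma> \<upsilon> P0 \<Lambda> k)"

definition converges_to_least_square_surface ::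
  "nat \<Rightarrow> (nat \<Rightarrow> real \<Rightarrow> real) \<Rightarrow> nat \<Rightarrow> (nat \<Rightarrow> real \<Rightarrow> real) \<Rightarrow>
   nat \<Rightarrow> (nat \<Rightarrow> real) \<Rightarrow> nat \<Rightarrow> (nat \<Rightarrow> real) \<Rightarrow> (nat \<Rightarrow> nat \<Rightarrow> real ^ 'd) \<Rightarrow>
   (nat \<Rightarrow> nat \<Rightarrow> nat \<Rightarrow> real ^ 'd) \<Rightarrow> bool" where
  "converges_to_least_square_surface n1 \<phi> n2 \<psi> m1 t m2 s Q P \<longleftrightarrow>
     (\<exists>L. least_square_control_points n1 \<phi> n2 \<psi> m1 t m2 s Q L \<and>
        (\<forall>i\<in>{1..n1}. \<forall>j\<in>{1..n2}. (\<lambda>k. P k i j) \<longlonglongrightarrow> L i j))"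

text \<open>
  The nonzero singular values in decreasing order: square roots of the nonzero eigenvalues of
  \<open>A\<^sup>T A\<close>, repeated according to multiplicity.
\<close>

definition nonzero_singular_values :: "real mat \<Rightarrow> real list" where
  "nonzero_singular_values A =
     rev (sorted_list_of_multiset
       (filter_mset (\<lambda>x. x \<noteq> 0) (image_mset sqrt (proots (char_poly (transpose_mat A * A))))))"

definition kronecker_mat :: "real mat \<Rightarrow> real mat \<Rightarrow> real mat" where
  "kronecker_mat A B =
     Matrix.mat (dim_row A * dim_row B) (dim_col A * dim_col B)
       (\<lambda>(i, j). A $$ (i div dim_row B, j div dim_col B) * B $$ (i mod dim_row B, j mod dim_col B))"

definition Sigma_mat :: "nat \<Rightarrow> real mat \<Rightarrow> real mat" where
  "Sigma_mat R B = mat_diag R (\<lambda>i. nonzero_singular_values B ! i)"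

definition H_hat :: "nat \<Rightarrow> nat \<Rightarrow> real mat \<Rightarrow> real \<Rightarrow> real \<Rightarrow> real \<Rightarrow> real mat" where
  "H_hat M R \<Sigma> \<omega> \<gamma> \<upsilon> =
     four_block_mat
       (four_block_mat
         ((1 - \<omega>) \<cdot>\<^sub>m 1\<^sub>m R - (\<gamma> * \<upsilon>) \<cdot>\<^sub>m (\<Sigma> * \<Sigma>)) (0\<^sub>m R (M - R))
         (0\<^sub>m (M - R) R)                       ((1 - \<omega>) \<cdot>\<^sub>m 1\<^sub>m (M - R)))
       (((- \<omega>) \<cdot>\<^sub>m \<Sigma>) @\<^sub>r 0\<^sub>m (M - R) R)
       (four_block_mat (\<upsilon> \<cdot>\<^sub>m \<Sigma>) (0\<^sub>m R (M - R)) (0\<^sub>m 0 R) (0\<^sub>m 0 (M - R)))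
       (1\<^sub>m R)"

definition convergence_rate :: "nat \<Rightarrow> nat \<Rightarrow> real mat \<Rightarrow> real \<Rightarrow> real \<Rightarrow> real \<Rightarrow> real" where
  "convergence_rate M R \<Sigma> \<omega> \<gamma> \<upsilon> =
     spectral_radius (map_mat complex_of_real (H_hat M R \<Sigma> \<omega> \<gamma> \<upsilon>))"

end

theory Submission
  imports Defs
begin

text \<open>
  Both parts hold because everything can be diagonalized. By the spectral theorem for real symmetric
  matrices (\<open>symmetric_mat_diagonalization\<close>), the Gram matrices of \<open>B1\<close> and \<open>B2\<close> have orthonormal
  eigenbases, and the products of their eigenvectors form an eigenbasis for the Gram matrix of
  \<open>B1 \<otimes> B2\<close>, with the products \<open>l\<close> of the eigenvalues.

  Convergence. In the coordinates of this eigenbasis the iteration splits into independent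
  recurrences (\<open>mlspia_converges\<close>). For \<open>l > 0\<close> the error of a coordinate satisfies
  \<open>z\<^sub>k\<^sub>+\<^sub>2 = p z\<^sub>k\<^sub>+\<^sub>1 - q z\<^sub>k\<close> with \<open>p = 2 - \<omega> - \<gamma> \<upsilon> l\<close> and \<open>q = 1 - \<omega> - \<gamma> \<upsilon> l + \<omega> \<upsilon> l\<close>, and it tends to zero when
  \<open>\<bar>p\<bar> < 1 + q\<close> and \<open>q < 1\<close>. For the largest eigenvalue \<open>l = (\<sigma> 1 * \<mu> 1)\<^sup>2\<close> these conditions are the
  assumed bounds on \<open>\<gamma>\<close>, and they carry over to all smaller eigenvalues. The coordinates for \<open>l = 0\<close>
  do not move at all. So the control points converge, and the limit solves the normal equations,
  which means that it is a least squares solution.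

  Convergence rate. The matrix \<open>H_hat\<close> decomposes into a scalar block \<open>1 - \<omega>\<close> and a two by two block
  for each singular value \<open>x\<close> of \<open>B1 \<otimes> B2\<close>, whose eigenvalues are the roots of \<open>k\<^sup>2 - p k + q\<close> for
  \<open>l = x\<^sup>2\<close>. At the given weights \<open>q = 1 - \<omega> = \<rho>\<^sup>2\<close> for all \<open>x\<close>, where \<open>\<rho> = (a - b) / (a + b)\<close>, and
  \<open>\<bar>p\<bar> \<le> 2 \<rho>\<close> whenever \<open>x\<close> lies between \<open>b\<close> and \<open>a\<close>. So the roots are complex conjugate or equal, and all of them have
  modulus \<open>\<rho>\<close> (\<open>H_hat_optimal_spectral_radius\<close>). About the singular values of the Kronecker product
  only their number and their range are needed (\<open>set_nonzero_singular_values_kronecker\<close>).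
\<close>

unbundle no vec_syntax and no inner_syntax

section \<open>The spectral theorem for real symmetric matrices\<close>

text \<open>For an eigenvector \<open>v\<close>, the form \<open>q = \<Sum>\<^sub>i \<Sum>\<^sub>j A\<^sub>i\<^sub>j cnj v\<^sub>i v\<^sub>j\<close> equals \<open>k\<close> times the squared
  norm of \<open>v\<close>; since \<open>A\<close> is real and symmetric, conjugating \<open>q\<close> only exchanges the summation indices.\<close>

lemma symmetric_real_eigenvalue:
  fixes A :: "real mat"
  assumes A: "A \<in> carrier_mat n n" and sym: "transpose_mat A = A"
    and k: "eigenvalue (map_mat complex_of_real A) k"
  shows "k \<in> \<real>"
proof -
  let ?C = "map_mat complex_of_real A"
  obtain v where v: "v \<in> carrier_vec n" "v \<noteq> 0\<^sub>v n" and ev: "?C *\<^sub>v v = k \<cdot>\<^sub>v v"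
    using k A unfolding eigenvalue_def eigenvector_def by auto
  have row: "(\<Sum>j<n. complex_of_real (A $$ (i, j)) * v $ j) = k * v $ i" if "i < n" for i
  proof -
    have "(?C *\<^sub>v v) $ i = (\<Sum>j<n. complex_of_real (A $$ (i, j)) * v $ j)"
      using A v(1) that by (auto simp: scalar_prod_def atLeast0LessThan intro!: sum.cong)
    then show ?thesis using ev v(1) that by simp
  qed
  have A_sym: "A $$ (i, j) = A $$ (j, i)" if "i < n" "j < n" for i j
    using arg_cong[OF sym, of "\<lambda>M. M $$ (i, j)"] A that by simp
  define q where "q = (\<Sum>i<n. \<Sum>j<n. complex_of_real (A $$ (i, j)) * cnj (v $ i) * v $ j)"
  define N where "N = (\<Sum>i<n. (cmod (v $ i))\<^sup>2)"
  have "q = (\<Sum>i<n. cnj (v $ i) * (k * v $ i))"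
    unfolding q_def by (rule sum.cong) (auto simp flip: row simp: sum_distrib_left mult_ac)
  also have "\<dots> = k * complex_of_real N"
    unfolding N_def of_real_sum sum_distrib_left
    by (rule sum.cong) (auto simp: complex_norm_square mult_ac simp del: of_real_power)
  finally have qk: "q = k * complex_of_real N" .
  have "cnj q = (\<Sum>i<n. \<Sum>j<n. complex_of_real (A $$ (i, j)) * v $ i * cnj (v $ j))"
    unfolding q_def by (simp add: mult_ac)
  also have "\<dots> = (\<Sum>j<n. \<Sum>i<n. complex_of_real (A $$ (i, j)) * v $ i * cnj (v $ j))"
    by (rule sum.swap)
  also have "\<dots> = q"
    unfolding q_def by (intro sum.cong) (auto simp: A_sym mult_ac)
  finally have "cnj q = q" .
  moreover obtain i where "i < n" "v $ i \<noteq> 0"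
    using v by (metis eq_vecI carrier_vecD index_zero_vec)
  then have "N \<noteq> 0"
    unfolding N_def by (subst sum_nonneg_eq_0_iff) auto
  ultimately have "cnj k = k"
    using qk by auto
  then show ?thesis
    by (simp add: complex_is_Real_iff complex_eq_iff)
qed

lemma symmetric_unit_eigenvector:
  fixes A :: "real mat"
  assumes A: "A \<in> carrier_mat n n" and sym: "transpose_mat A = A" and n: "n > 0"
  obtains v e where "v \<in> carrier_vec n" "v \<bullet> v = 1" "A *\<^sub>v v = e \<cdot>\<^sub>v v"
proof -
  let ?C = "map_mat complex_of_real A"
  have C: "?C \<in> carrier_mat n n" using A by simp
  obtain k where k: "eigenvalue ?C k"
    using spectrum_non_empty[OF C] n unfolding spectrum_def by auto
  then obtain e where e: "k = complex_of_real e"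
    using symmetric_real_eigenvalue[OF A sym] by (auto elim: Reals_cases)
  have "poly (map_poly complex_of_real (char_poly A)) (complex_of_real e) = 0"
    using k unfolding eigenvalue_root_char_poly[OF C] of_real_hom.char_poly_hom[OF A] e .
  then have "eigenvalue A e"
    unfolding eigenvalue_root_char_poly[OF A] by simp
  then obtain w where w: "w \<in> carrier_vec n" "w \<noteq> 0\<^sub>v n" "A *\<^sub>v w = e \<cdot>\<^sub>v w"
    using A unfolding eigenvalue_def eigenvector_def by auto
  have pos: "w \<bullet> w > 0"
    using conjugate_square_greater_0_vec[OF w(1)] w(2) by simp
  define c where "c = 1 / sqrt (w \<bullet> w)"
  show thesis
  proof
    show "c \<cdot>\<^sub>v w \<in> carrier_vec n" using w by simp
    have "(c \<cdot>\<^sub>v w) \<bullet> (c \<cdot>\<^sub>v w) = c\<^sup>2 * (w \<bullet> w)"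
      using w(1) by (simp add: power2_eq_square)
    also have "\<dots> = 1" using pos by (simp add: c_def power_divide)
    finally show "(c \<cdot>\<^sub>v w) \<bullet> (c \<cdot>\<^sub>v w) = 1" .
    show "A *\<^sub>v (c \<cdot>\<^sub>v w) = e \<cdot>\<^sub>v (c \<cdot>\<^sub>v w)"
      using w A by (simp add: mult_mat_vec smult_smult_assoc mult.commute)
  qed
qed

text \<open>A symmetric orthogonal matrix with prescribed first column allows the deflation step of the
  spectral theorem without extending \<open>v\<close> to a basis and orthonormalizing it. The reflection is along
  \<open>w = e\<^sub>0 - v\<close>, whose squared length is \<open>s = 2 w\<^sub>0\<close> because \<open>v\<close> is a unit vector. If \<open>v = e\<^sub>0\<close>, then
  \<open>s = 0\<close>, and division by zero makes the matrix the identity, as it should be.\<close>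

lemma householder_reflection:
  fixes v :: "real vec"
  assumes v: "v \<in> carrier_vec n" "v \<bullet> v = 1" and n: "n > 0"
  obtains H where "H \<in> carrier_mat n n" "transpose_mat H = H" "H * H = 1\<^sub>m n" "H *\<^sub>v unit_vec n 0 = v"
proof -
  define w where "w i = (if i = 0 then 1 else 0) - v $ i" for i
  define s where "s = (\<Sum>i<n. (w i)\<^sup>2)"
  define H where "H = Matrix.mat n n (\<lambda>(i, j). (if i = j then 1 else 0) - 2 * w i * w j / s)"
  have vv: "(\<Sum>i<n. (v $ i)\<^sup>2) = 1"
    using v by (simp add: scalar_prod_def power2_eq_square atLeast0LessThan)
  have "s = (\<Sum>i<n. (if i = 0 then 1 - 2 * v $ i else 0) + (v $ i)\<^sup>2)"
    unfolding s_def w_def by (rule sum.cong) (auto simp: power2_eq_square algebra_simps)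
  also have "\<dots> = 2 * w 0"
    using n vv by (simp add: sum.distrib w_def)
  finally have s: "s = 2 * w 0" .
  show thesis
  proof
    show H: "H \<in> carrier_mat n n" unfolding H_def by simp
    show "transpose_mat H = H" unfolding H_def by (rule eq_matI) auto
    show "H * H = 1\<^sub>m n"
    proof (rule eq_matI)
      fix i j assume ij: "i < dim_row (1\<^sub>m n :: real mat)" "j < dim_col (1\<^sub>m n :: real mat)"
      have "(H * H) $$ (i, j) = (\<Sum>k<n. ((if i = k then 1 else 0) - 2 * w i * w k / s) *
              ((if k = j then 1 else 0) - 2 * w k * w j / s))"
        using ij by (simp add: H_def scalar_prod_def atLeast0LessThan)
      also have "\<dots> = (\<Sum>k<n. (if k = i then (if i = j then 1 else 0) - 2 * w i * w j / s else 0)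
          + (if k = j then - 2 * w i * w j / s else 0) + 4 * w i * w j / s\<^sup>2 * (w k)\<^sup>2)"
        by (rule sum.cong) (auto simp: algebra_simps power2_eq_square)
      also have "\<dots> = (if i = j then 1 else 0) - 4 * w i * w j / s + 4 * w i * w j / s\<^sup>2 * s"
        using ij unfolding sum.distrib s_def sum_distrib_left[symmetric] by simp
      also have "\<dots> = 1\<^sub>m n $$ (i, j)"
        using ij by (simp add: power2_eq_square)
      finally show "(H * H) $$ (i, j) = 1\<^sub>m n $$ (i, j)" .
    qed (use H in auto)
    show "H *\<^sub>v unit_vec n 0 = v"
    proof (rule eq_vecI)
      fix i assume i: "i < dim_vec v"
      have "(H *\<^sub>v unit_vec n 0) $ i = H $$ (i, 0)"
        using i v n by (simp add: H_def)
      also have "\<dots> = (if i = 0 then 1 else 0) - w i * (2 * w 0 / s)"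
        using i v n by (simp add: H_def)
      also have "w i * (2 * w 0 / s) = w i"
      proof (cases "s = 0")
        case True
        then have "w i = 0" using i v unfolding s_def by (subst (asm) sum_nonneg_eq_0_iff) auto
        then show ?thesis by simp
      qed (use s in auto)
      finally show "(H *\<^sub>v unit_vec n 0) $ i = v $ i" by (simp add: w_def)
    qed (use H v in auto)
  qed
qed
definition block_diag1 :: "real \<Rightarrow> real mat \<Rightarrow> real mat" where
  "block_diag1 e M = four_block_mat (Matrix.mat 1 1 (\<lambda>_. e)) (0\<^sub>m 1 (dim_col M)) (0\<^sub>m (dim_row M) 1) M"

text \<open>Induction by deflation: conjugating \<open>A\<close> with the Householder reflection \<open>H\<close> that maps \<open>e\<^sub>0\<close> to a unit
  eigenvector gives a matrix whose first column is a multiple of \<open>e\<^sub>0\<close>. By symmetry so is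
  its first row, hence it is block diagonal, and the induction hypothesis applies to the lower block.\<close>

lemma symmetric_mat_diagonalization:
  fixes A :: "real mat"
  assumes "A \<in> carrier_mat n n" and "transpose_mat A = A"
  shows "\<exists>U d. U \<in> carrier_mat n n \<and> transpose_mat U * U = 1\<^sub>m n \<and>
           transpose_mat U * A * U = mat_diag n d"
  using assms
proof (induction n arbitrary: A)
  case 0
  show ?case
    by (rule exI[of _ "1\<^sub>m 0"], rule exI[of _ "\<lambda>_. 0"]) (use 0 in \<open>auto intro!: eq_matI simp: mat_diag_def\<close>)
next
  case (Suc n)
  note A = Suc.prems(1) and sym = Suc.prems(2)
  obtain v e where v: "v \<in> carrier_vec (Suc n)" "v \<bullet> v = 1" and ev: "A *\<^sub>v v = e \<cdot>\<^sub>v v"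
    using symmetric_unit_eigenvector[OF A sym] by blast
  obtain H where H: "H \<in> carrier_mat (Suc n) (Suc n)" "transpose_mat H = H" "H * H = 1\<^sub>m (Suc n)"
    and He: "H *\<^sub>v unit_vec (Suc n) 0 = v"
    using householder_reflection[OF v] by blast
  define M where "M = H * A * H"
  have M: "M \<in> carrier_mat (Suc n) (Suc n)" using H A unfolding M_def by simp
  have "transpose_mat M = M"
    unfolding M_def using H(1,2) A sym
    by (simp add: transpose_mult[of _ "Suc n" "Suc n" _ "Suc n"] assoc_mult_mat[of _ "Suc n" "Suc n" _ "Suc n" _ "Suc n"])
  then have M_sym: "M $$ (i, j) = M $$ (j, i)" if "i < Suc n" "j < Suc n" for i j
    using arg_cong[of _ _ "\<lambda>M. M $$ (i, j)"] M that by (metis carrier_matD index_transpose_mat(1))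
  have Hv: "H *\<^sub>v v = unit_vec (Suc n) 0"
    using H by (simp flip: He add: assoc_mult_mat_vec[of _ "Suc n" "Suc n" _ "Suc n", symmetric])
  have "M *\<^sub>v unit_vec (Suc n) 0 = H *\<^sub>v (A *\<^sub>v v)"
    using H A by (simp add: M_def He assoc_mult_mat_vec[of _ "Suc n" "Suc n" _ "Suc n"])
  also have "\<dots> = e \<cdot>\<^sub>v unit_vec (Suc n) 0"
    using H v by (simp add: ev Hv mult_mat_vec)
  finally have col0: "M *\<^sub>v unit_vec (Suc n) 0 = e \<cdot>\<^sub>v unit_vec (Suc n) 0" .
  have Mi0: "M $$ (i, 0) = (if i = 0 then e else 0)" if "i < Suc n" for i
    using arg_cong[OF col0, of "\<lambda>v. v $ i"] M that by (simp add: mult_mat_vec_def)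
  define N where "N = Matrix.mat n n (\<lambda>(i, j). M $$ (Suc i, Suc j))"
  have N: "N \<in> carrier_mat n n" unfolding N_def by simp
  have M_block: "M = block_diag1 e N"
    by (rule eq_matI) (use M in \<open>auto simp: block_diag1_def N_def Mi0 M_sym[of 0] less_Suc_eq_0_disj\<close>)
  have "transpose_mat N = N"
    by (rule eq_matI) (auto simp: N_def M_sym)
  from Suc.IH[OF N this] obtain V d where V: "V \<in> carrier_mat n n" "transpose_mat V * V = 1\<^sub>m n"
    "transpose_mat V * N * V = mat_diag n d" by blast
  define W where "W = block_diag1 1 V"
  have W: "W \<in> carrier_mat (Suc n) (Suc n)" using V(1) unfolding W_def block_diag1_def by auto
  have WT: "transpose_mat W = block_diag1 1 (transpose_mat V)"
    unfolding W_def block_diag1_def using V(1)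
    by (subst transpose_four_block_mat[of _ 1 1 _ n _ n]) (auto intro!: cong_four_block_mat eq_matI)
  have mult: "block_diag1 x X * block_diag1 y Y = block_diag1 (x * y) (X * Y)"
    if "X \<in> carrier_mat n n" "Y \<in> carrier_mat n n" for x y X Y
    unfolding block_diag1_def using that
    by (subst mult_four_block_mat[of _ 1 1 _ n _ n _ _ 1 _ n])
      (auto intro!: cong_four_block_mat eq_matI simp: scalar_prod_def)
  have one: "block_diag1 1 (1\<^sub>m n) = 1\<^sub>m (Suc n)"
    by (rule eq_matI) (auto simp: block_diag1_def)
  have WTW: "transpose_mat W * W = 1\<^sub>m (Suc n)"
    unfolding WT unfolding W_def using V by (simp add: mult one)
  define U where "U = H * W"
  have U: "U \<in> carrier_mat (Suc n) (Suc n)" unfolding U_def using H W by simp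
  have UT: "transpose_mat U = transpose_mat W * H"
    unfolding U_def using H W by (simp add: transpose_mult[of _ "Suc n" "Suc n" _ "Suc n"])
  note assoc = assoc_mult_mat[of _ "Suc n" "Suc n" _ "Suc n" _ "Suc n"]
  have WT': "transpose_mat W \<in> carrier_mat (Suc n) (Suc n)" using W by simp
  have "transpose_mat U * U = transpose_mat W * (H * H * W)"
    unfolding UT unfolding U_def using H(1) W WT' by (simp add: assoc)
  then have UTU: "transpose_mat U * U = 1\<^sub>m (Suc n)"
    using W by (simp add: H(3) WTW)
  have "transpose_mat U * A * U = transpose_mat W * M * W"
    unfolding UT M_def unfolding U_def using H(1) W WT' A by (simp add: assoc)
  also have "\<dots> = block_diag1 e (mat_diag n d)"
    unfolding WT M_block unfolding W_def using V N by (simp add: mult)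
  also have "\<dots> = mat_diag (Suc n) (\<lambda>i. case i of 0 \<Rightarrow> e | Suc i \<Rightarrow> d i)"
    by (rule eq_matI) (auto simp: block_diag1_def mat_diag_def split: nat.splits)
  finally show ?case using U UTU by blast
qed

section \<open>Singular values of Kronecker products\<close>

lemma div_mod_less:
  fixes k :: nat assumes "k < a * b"
  shows "k div b < a" "k mod b < b"
  using assms by (auto simp: less_mult_imp_div_less intro!: mod_less_divisor gr0I)

lemma bij_betw_div_mod:
  "bij_betw (\<lambda>k. (k div b, k mod b)) {..<a * b} ({..<a} \<times> {..<b :: nat})"
proof (rule bij_betw_imageI)
  show "inj_on (\<lambda>k. (k div b, k mod b)) {..<a * b}"
    by (rule inj_onI) (metis div_mult_mod_eq prod.inject)
  show "(\<lambda>k. (k div b, k mod b)) ` {..<a * b} = {..<a} \<times> {..<b}"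
  proof (intro equalityI subsetI)
    fix x assume "x \<in> {..<a} \<times> {..<b}"
    then obtain i j where x: "x = (i, j)" "i < a" "j < b" by auto
    have "i * b + j < Suc i * b" using x by simp
    also have "\<dots> \<le> a * b" using x by (intro mult_le_mono1) simp
    finally have "i * b + j < a * b" .
    then show "x \<in> (\<lambda>k. (k div b, k mod b)) ` {..<a * b}"
      using x by (intro image_eqI[of _ _ "i * b + j"]) auto
  qed (auto simp: div_mod_less)
qed

lemma kronecker_mat_carrier [simp]:
  "A \<in> carrier_mat m n \<Longrightarrow> B \<in> carrier_mat p q \<Longrightarrow> kronecker_mat A B \<in> carrier_mat (m * p) (n * q)"
  unfolding kronecker_mat_def by auto

lemma index_kronecker_mat:
  assumes "A \<in> carrier_mat m n" "B \<in> carrier_mat p q" "i < m * p" "j < n * q"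
  shows "kronecker_mat A B $$ (i, j) = A $$ (i div p, j div q) * B $$ (i mod p, j mod q)"
  using assms unfolding kronecker_mat_def by auto

lemma transpose_kronecker_mat:
  assumes A: "A \<in> carrier_mat m n" and B: "B \<in> carrier_mat p q"
  shows "transpose_mat (kronecker_mat A B) = kronecker_mat (transpose_mat A) (transpose_mat B)"
  by (rule eq_matI) (use A B in \<open>auto simp: kronecker_mat_def div_mod_less\<close>)

text \<open>The mixed-product rule: writing a column index as \<open>x q + y\<close> turns the sum over it into a sum over
  pairs \<open>(x, y)\<close>, which factors.\<close>

lemma kronecker_mat_mult:
  assumes A: "A \<in> carrier_mat m n" and B: "B \<in> carrier_mat p q"
    and C: "C \<in> carrier_mat n m'" and D: "D \<in> carrier_mat q p'"
  shows "kronecker_mat A B * kronecker_mat C D = kronecker_mat (A * C) (B * D)"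
proof (rule eq_matI)
  have AC: "A * C \<in> carrier_mat m m'" and BD: "B * D \<in> carrier_mat p p'" using A B C D by auto
  have AB: "kronecker_mat A B \<in> carrier_mat (m * p) (n * q)" using A B by simp
  have CD: "kronecker_mat C D \<in> carrier_mat (n * q) (m' * p')" using C D by simp
  show "dim_row (kronecker_mat A B * kronecker_mat C D) = dim_row (kronecker_mat (A * C) (B * D))"
    "dim_col (kronecker_mat A B * kronecker_mat C D) = dim_col (kronecker_mat (A * C) (B * D))"
    using A B C D by (auto simp: kronecker_mat_def)
  fix i j assume "i < dim_row (kronecker_mat (A * C) (B * D))" "j < dim_col (kronecker_mat (A * C) (B * D))"
  then have i: "i < m * p" and j: "j < m' * p'" using A B C D by (auto simp: kronecker_mat_def)
  note ij = div_mod_less[OF i] div_mod_less[OF j]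
  let ?f = "\<lambda>x. A $$ (i div p, x) * C $$ (x, j div p')" and ?g = "\<lambda>y. B $$ (i mod p, y) * D $$ (y, j mod p')"
  have "(kronecker_mat A B * kronecker_mat C D) $$ (i, j)
      = (\<Sum>k<n * q. kronecker_mat A B $$ (i, k) * kronecker_mat C D $$ (k, j))"
    using AB CD i j by (simp add: scalar_prod_def atLeast0LessThan)
  also have "\<dots> = (\<Sum>k<n * q. (\<lambda>(x, y). ?f x * ?g y) (k div q, k mod q))"
    by (rule sum.cong) (auto simp: index_kronecker_mat[OF A B i] index_kronecker_mat[OF C D _ j])
  also have "\<dots> = (\<Sum>(x, y)\<in>{..<n} \<times> {..<q}. ?f x * ?g y)"
    by (rule sum.reindex_bij_betw[OF bij_betw_div_mod])
  also have "\<dots> = (\<Sum>x<n. ?f x) * (\<Sum>y<q. ?g y)"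
    by (simp add: sum_product sum.cartesian_product)
  also have "(\<Sum>x<n. ?f x) = (A * C) $$ (i div p, j div p')"
    using A C ij by (simp add: scalar_prod_def atLeast0LessThan)
  also have "(\<Sum>y<q. ?g y) = (B * D) $$ (i mod p, j mod p')"
    using B D ij by (simp add: scalar_prod_def atLeast0LessThan)
  finally show "(kronecker_mat A B * kronecker_mat C D) $$ (i, j) = kronecker_mat (A * C) (B * D) $$ (i, j)"
    by (simp add: index_kronecker_mat[OF AC BD i j])
qed

lemma kronecker_mat_diag:
  "kronecker_mat (mat_diag n d) (mat_diag q e) = mat_diag (n * q) (\<lambda>k. d (k div q) * e (k mod q))"
proof (rule eq_matI)
  fix i j assume "i < dim_row (mat_diag (n * q) (\<lambda>k. d (k div q) * e (k mod q)))"
    "j < dim_col (mat_diag (n * q) (\<lambda>k. d (k div q) * e (k mod q)))"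
  then have i: "i < n * q" and j: "j < n * q" by (auto simp: mat_diag_def)
  have "i = j \<longleftrightarrow> i div q = j div q \<and> i mod q = j mod q"
    by (metis div_mult_mod_eq)
  then show "kronecker_mat (mat_diag n d) (mat_diag q e) $$ (i, j) =
      mat_diag (n * q) (\<lambda>k. d (k div q) * e (k mod q)) $$ (i, j)"
    using i j div_mod_less[OF i] div_mod_less[OF j]
    by (auto simp: index_kronecker_mat[of _ n n _ q q] mat_diag_def)
qed (auto simp: kronecker_mat_def mat_diag_def)

text \<open>Singular values are only ever accessed through an orthogonal diagonalization of the Gram matrix
  \<open>B\<^sup>T B\<close>: it is what passes to Kronecker products, and its diagonal determines the singular values.\<close>

definition diagonalizes_gram :: "real mat \<Rightarrow> nat \<Rightarrow> real mat \<Rightarrow> (nat \<Rightarrow> real) \<Rightarrow> bool" where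
  "diagonalizes_gram B n U d \<longleftrightarrow> U \<in> carrier_mat n n \<and> transpose_mat U * U = 1\<^sub>m n \<and>
     transpose_mat U * (transpose_mat B * B) * U = mat_diag n d"

lemma diagonalizes_gram_exists:
  assumes "B \<in> carrier_mat m n"
  shows "\<exists>U d. diagonalizes_gram B n U d"
  unfolding diagonalizes_gram_def
  by (rule symmetric_mat_diagonalization) (use assms in \<open>auto simp: transpose_mult[of _ n m _ n]\<close>)

lemma diagonalizes_gram_kronecker:
  assumes B: "B1 \<in> carrier_mat m1 n1" "B2 \<in> carrier_mat m2 n2"
    and "diagonalizes_gram B1 n1 U1 d1" and "diagonalizes_gram B2 n2 U2 d2"
  shows "diagonalizes_gram (kronecker_mat B1 B2) (n1 * n2) (kronecker_mat U1 U2) (\<lambda>k. d1 (k div n2) * d2 (k mod n2))"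
proof -
  have U: "U1 \<in> carrier_mat n1 n1" "U2 \<in> carrier_mat n2 n2"
    and one: "transpose_mat U1 * U1 = 1\<^sub>m n1" "transpose_mat U2 * U2 = 1\<^sub>m n2"
    and diag: "transpose_mat U1 * (transpose_mat B1 * B1) * U1 = mat_diag n1 d1"
      "transpose_mat U2 * (transpose_mat B2 * B2) * U2 = mat_diag n2 d2"
    using assms(3,4) unfolding diagonalizes_gram_def by blast+
  have UT: "transpose_mat U1 \<in> carrier_mat n1 n1" "transpose_mat U2 \<in> carrier_mat n2 n2" using U by auto
  have BT: "transpose_mat B1 \<in> carrier_mat n1 m1" "transpose_mat B2 \<in> carrier_mat n2 m2" using B by auto
  have BTB: "transpose_mat B1 * B1 \<in> carrier_mat n1 n1" "transpose_mat B2 * B2 \<in> carrier_mat n2 n2" using B by auto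
  have UTBTB: "transpose_mat U1 * (transpose_mat B1 * B1) \<in> carrier_mat n1 n1"
    "transpose_mat U2 * (transpose_mat B2 * B2) \<in> carrier_mat n2 n2" using UT BTB by auto
  have "kronecker_mat (1\<^sub>m n1) (1\<^sub>m n2) = (1\<^sub>m (n1 * n2) :: real mat)"
    using kronecker_mat_diag[of n1 "\<lambda>_. 1 :: real" n2 "\<lambda>_. 1"] by simp
  then show ?thesis
    unfolding diagonalizes_gram_def transpose_kronecker_mat[OF U] transpose_kronecker_mat[OF B]
      kronecker_mat_mult[OF UT U] kronecker_mat_mult[OF BT B] kronecker_mat_mult[OF UT BTB]
      kronecker_mat_mult[OF UTBTB U] one diag kronecker_mat_diag
    using U by simp
qed

text \<open>Similar matrices have the same characteristic polynomial, and that of a diagonal matrix has the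
  diagonal entries as roots.\<close>

lemma mset_nonzero_singular_values:
  assumes B: "B \<in> carrier_mat m n" and U: "diagonalizes_gram B n U d"
  shows "mset (nonzero_singular_values B) = image_mset (\<lambda>i. sqrt (d i)) (mset_set {i. i < n \<and> d i \<noteq> 0})"
proof -
  let ?G = "transpose_mat B * B"
  have carrier: "U \<in> carrier_mat n n" "transpose_mat U \<in> carrier_mat n n" "?G \<in> carrier_mat n n"
    using B U unfolding diagonalizes_gram_def by auto
  have UTU: "transpose_mat U * U = 1\<^sub>m n" and diag: "transpose_mat U * ?G * U = mat_diag n d"
    using U unfolding diagonalizes_gram_def by blast+
  have "U * transpose_mat U = 1\<^sub>m n"
    using mat_mult_left_right_inverse[OF carrier(2,1) UTU] .
  with UTU carrier have "similar_mat (mat_diag n d) ?G"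
    by (intro similar_matI[of _ _ "transpose_mat U" U n]) (auto simp: diag)
  then have "char_poly ?G = char_poly (mat_diag n d)"
    by (rule char_poly_similar[symmetric])
  also have "\<dots> = (\<Prod>a\<leftarrow>diag_mat (mat_diag n d). [:- a, 1:])"
    by (rule char_poly_upper_triangular[of _ n]) (auto simp: mat_diag_def)
  also have "diag_mat (mat_diag n d) = map d [0..<n]"
    by (auto simp: diag_mat_def mat_diag_def)
  finally have "char_poly ?G = (\<Prod>a\<leftarrow>map d [0..<n]. [:- a, 1:])" .
  moreover have "proots (\<Prod>a\<leftarrow>xs. [:- a, 1:]) = mset xs" for xs :: "real list"
  proof (induction xs)
    case (Cons x xs)
    have "(\<Prod>a\<leftarrow>xs. [:- a, 1:]) \<noteq> 0" by (auto simp: prod_list_zero_iff)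
    then show ?case using Cons.IH by (simp add: proots_mult del: mult_pCons_left)
  qed simp
  ultimately have "proots (char_poly ?G) = mset (map d [0..<n])"
    by (simp only:)
  also have "\<dots> = image_mset d (mset_set {..<n})"
    by (simp add: atLeast0LessThan)
  finally have "proots (char_poly ?G) = image_mset d (mset_set {..<n})" .
  then have "mset (nonzero_singular_values B) = filter_mset (\<lambda>x. x \<noteq> 0) (image_mset (\<lambda>i. sqrt (d i)) (mset_set {..<n}))"
    unfolding nonzero_singular_values_def by (simp add: image_mset.compositionality o_def)
  also have "\<dots> = image_mset (\<lambda>i. sqrt (d i)) (filter_mset (\<lambda>i. d i \<noteq> 0) (mset_set {..<n}))"
    by (simp add: filter_mset_image_mset)
  also have "filter_mset (\<lambda>i. d i \<noteq> 0) (mset_set {..<n}) = mset_set {i. i < n \<and> d i \<noteq> 0}"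
    by (simp add: filter_mset_mset_set Collect_conj_eq lessThan_def)
  finally show ?thesis .
qed

lemma sorted_nonzero_singular_values: "sorted_wrt (\<ge>) (nonzero_singular_values B)"
  unfolding nonzero_singular_values_def by (simp add: sorted_wrt_rev)

lemma set_nonzero_singular_values:
  assumes "B \<in> carrier_mat m n" and "diagonalizes_gram B n U d"
  shows "set (nonzero_singular_values B) = (\<lambda>i. sqrt (d i)) ` {i. i < n \<and> d i \<noteq> 0}"
proof -
  have "set (nonzero_singular_values B) = set_mset (mset (nonzero_singular_values B))" by simp
  also have "\<dots> = (\<lambda>i. sqrt (d i)) ` {i. i < n \<and> d i \<noteq> 0}"
    unfolding mset_nonzero_singular_values[OF assms] by simp
  finally show ?thesis .
qed

lemma length_nonzero_singular_values:
  assumes "B \<in> carrier_mat m n" and "diagonalizes_gram B n U d"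
  shows "length (nonzero_singular_values B) = card {i. i < n \<and> d i \<noteq> 0}"
  using arg_cong[OF mset_nonzero_singular_values[OF assms], of size] by simp

text \<open>The eigenvalues of the Gram matrix of a Kronecker product are the products of those of the
  factors, and such a product is nonzero iff both factors are. At the weights
  considered, the spectral radius is determined once all singular values are known to lie in an
  interval, so a bound for their set and their number suffice.\<close>

lemma set_nonzero_singular_values_kronecker:
  assumes B: "B1 \<in> carrier_mat m1 n1" "B2 \<in> carrier_mat m2 n2"
  shows "set (nonzero_singular_values (kronecker_mat B1 B2)) \<subseteq>
    {x * y |x y. x \<in> set (nonzero_singular_values B1) \<and> y \<in> set (nonzero_singular_values B2)}" (is ?set)
    and "length (nonzero_singular_values (kronecker_mat B1 B2)) =
      length (nonzero_singular_values B1) * length (nonzero_singular_values B2)" (is ?length)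
proof -
  obtain U1 d1 U2 d2 where D: "diagonalizes_gram B1 n1 U1 d1" "diagonalizes_gram B2 n2 U2 d2"
    using diagonalizes_gram_exists[OF B(1)] diagonalizes_gram_exists[OF B(2)] by auto
  note K = kronecker_mat_carrier[OF B] diagonalizes_gram_kronecker[OF B D]
  let ?d = "\<lambda>k. d1 (k div n2) * d2 (k mod n2)"
  show ?set
  proof
    fix x assume "x \<in> set (nonzero_singular_values (kronecker_mat B1 B2))"
    then obtain k where k: "k < n1 * n2" "?d k \<noteq> 0" "x = sqrt (?d k)"
      unfolding set_nonzero_singular_values[OF K] by auto
    then have "sqrt (d1 (k div n2)) \<in> set (nonzero_singular_values B1)"
      "sqrt (d2 (k mod n2)) \<in> set (nonzero_singular_values B2)"
      unfolding set_nonzero_singular_values[OF B(1) D(1)] set_nonzero_singular_values[OF B(2) D(2)]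
      using div_mod_less[OF k(1)] by auto
    moreover have "x = sqrt (d1 (k div n2)) * sqrt (d2 (k mod n2))"
      using k(3) by (simp add: real_sqrt_mult)
    ultimately show "x \<in> {x * y |x y. x \<in> set (nonzero_singular_values B1) \<and> y \<in> set (nonzero_singular_values B2)}"
      by blast
  qed
  have "bij_betw (\<lambda>k. (k div n2, k mod n2)) {k \<in> {..<n1 * n2}. ?d k \<noteq> 0}
          {x \<in> {..<n1} \<times> {..<n2}. d1 (fst x) * d2 (snd x) \<noteq> 0}"
    by (rule bij_betw_Collect[OF bij_betw_div_mod]) simp
  then have "card {k. k < n1 * n2 \<and> ?d k \<noteq> 0} = card {x \<in> {..<n1} \<times> {..<n2}. d1 (fst x) * d2 (snd x) \<noteq> 0}"
    by (simp add: bij_betw_same_card)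
  also have "{x \<in> {..<n1} \<times> {..<n2}. d1 (fst x) * d2 (snd x) \<noteq> 0}
     = {i. i < n1 \<and> d1 i \<noteq> 0} \<times> {i. i < n2 \<and> d2 i \<noteq> 0}" by auto
  finally show ?length
    unfolding length_nonzero_singular_values[OF K] length_nonzero_singular_values[OF B(1) D(1)]
      length_nonzero_singular_values[OF B(2) D(2)]
    by (simp add: card_cartesian_product)
qed

section \<open>Convergence of the iteration for a general collocation matrix\<close>

text \<open>The assumptions on \<open>p\<close> and \<open>q\<close> are the Schur-Cohn conditions, saying that both roots of
  \<open>X\<^sup>2 - p X + q\<close> lie inside the unit circle. A Lyapunov function avoids the case distinction between
  real, double and complex roots: the quadratic form \<open>V\<close> is nonnegative because \<open>\<bar>p\<bar> < 1 + q\<close>, and along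
  the recurrence it decreases by \<open>(1 - q) \<parallel>x\<^sub>k - x\<^sub>k\<^sub>+\<^sub>2\<parallel>\<^sup>2\<close>. Hence \<open>x\<^sub>k - x\<^sub>k\<^sub>+\<^sub>2\<close> tends to zero, and by the
  recurrence \<open>x\<^sub>k\<close> is a fixed linear combination of two consecutive differences of this kind.\<close>

lemma second_order_recurrence_tendsto_zero:
  fixes x :: "nat \<Rightarrow> 'a :: real_inner"
  assumes rec: "\<And>k. x (Suc (Suc k)) = p *\<^sub>R x (Suc k) - q *\<^sub>R x k"
    and p: "\<bar>p\<bar> < 1 + q" and q: "q < 1"
  shows "x \<longlonglongrightarrow> 0"
proof -
  define V where "V k = (1 + q) * ((norm (x k))\<^sup>2 + (norm (x (Suc k)))\<^sup>2)
    - 2 * p * inner (x k) (x (Suc k))" for k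
  have drop: "V k - V (Suc k) = (1 - q) * (norm (x k - x (Suc (Suc k))))\<^sup>2" for k
  proof -
    define X Y Z where "X = inner (x k) (x k)" and "Y = inner (x (Suc k)) (x (Suc k))"
      and "Z = inner (x k) (x (Suc k))"
    have next_sq: "(norm (x (Suc (Suc k))))\<^sup>2 = p\<^sup>2 * Y - 2 * p * q * Z + q\<^sup>2 * X"
      unfolding rec power2_norm_eq_inner X_def Y_def Z_def
      by (simp add: inner_diff_left inner_diff_right inner_commute[of "x (Suc k)" "x k"] power2_eq_square algebra_simps)
    have next_inner: "inner (x (Suc k)) (x (Suc (Suc k))) = p * Y - q * Z"
      "inner (x k) (x (Suc (Suc k))) = p * Z - q * X"
      unfolding rec X_def Y_def Z_def
      by (simp_all add: inner_diff_right inner_commute[of "x (Suc k)" "x k"])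
    have "(norm (x k - x (Suc (Suc k))))\<^sup>2
        = X - 2 * inner (x k) (x (Suc (Suc k))) + (norm (x (Suc (Suc k))))\<^sup>2"
      unfolding X_def power2_norm_eq_inner
      by (simp add: inner_diff_left inner_diff_right inner_commute)
    note diff_sq = this[unfolded next_inner next_sq]
    have norms: "(norm (x k))\<^sup>2 = X" "(norm (x (Suc k)))\<^sup>2 = Y"
      by (simp_all add: X_def Y_def power2_norm_eq_inner)
    show ?thesis
      unfolding V_def diff_sq norms next_inner next_sq Z_def[symmetric]
      by (simp add: algebra_simps power2_eq_square)
  qed
  have V_nonneg: "0 \<le> V k" for k
  proof -
    define a b where "a = norm (x k)" and "b = norm (x (Suc k))"
    have "\<bar>2 * p * inner (x k) (x (Suc k))\<bar> \<le> \<bar>p\<bar> * (2 * (a * b))"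
      using mult_left_mono[OF Cauchy_Schwarz_ineq2[of "x k" "x (Suc k)"], of "2 * \<bar>p\<bar>"]
      by (simp add: abs_mult a_def b_def)
    also have "\<dots> \<le> \<bar>p\<bar> * (a\<^sup>2 + b\<^sup>2)"
      using sum_squares_bound[of a b] by (intro mult_left_mono) auto
    also have "\<dots> \<le> (1 + q) * (a\<^sup>2 + b\<^sup>2)"
      using p by (intro mult_right_mono) auto
    finally show ?thesis unfolding V_def a_def b_def by linarith
  qed
  have "decseq V"
    using drop q by (intro decseq_SucI) (smt (verit) mult_nonneg_nonneg zero_le_power2)
  then obtain L where "V \<longlonglongrightarrow> L"
    using decseq_convergent V_nonneg by metis
  then have "(\<lambda>k. (V k - V (Suc k)) / (1 - q)) \<longlonglongrightarrow> (L - L) / (1 - q)"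
    by (intro tendsto_intros LIMSEQ_Suc) (use q in auto)
  then have "(\<lambda>k. (norm (x k - x (Suc (Suc k))))\<^sup>2) \<longlonglongrightarrow> 0"
    using q by (simp add: drop)
  then have "(\<lambda>k. sqrt ((norm (x k - x (Suc (Suc k))))\<^sup>2)) \<longlonglongrightarrow> sqrt 0"
    by (rule tendsto_real_sqrt)
  then have diff: "(\<lambda>k. x k - x (Suc (Suc k))) \<longlonglongrightarrow> 0"
    by (simp add: tendsto_norm_zero_iff)
  let ?u = "\<lambda>k. x k - x (Suc (Suc k))" and ?c = "(1 + q)\<^sup>2 - p\<^sup>2"
  have "?c > 0"
    using p power_strict_mono[of "\<bar>p\<bar>" "1 + q" 2] by simp
  have "(\<lambda>k. (1 / ?c) *\<^sub>R ((1 + q) *\<^sub>R ?u k + p *\<^sub>R (?u (Suc k) - p *\<^sub>R ?u k)))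
      \<longlonglongrightarrow> (1 / ?c) *\<^sub>R ((1 + q) *\<^sub>R 0 + p *\<^sub>R (0 - p *\<^sub>R 0))"
    by (intro tendsto_intros diff LIMSEQ_Suc[OF diff])
  moreover have "(1 / ?c) *\<^sub>R ((1 + q) *\<^sub>R ?u k + p *\<^sub>R (?u (Suc k) - p *\<^sub>R ?u k)) = x k" for k
  proof -
    have double: "(q * 2) *\<^sub>R x k = q *\<^sub>R x k + q *\<^sub>R x k"
      by (metis mult_2_right scaleR_left_distrib)
    have "(1 + q) *\<^sub>R ?u k + p *\<^sub>R (?u (Suc k) - p *\<^sub>R ?u k) = ?c *\<^sub>R x k"
      using double by (simp add: rec algebra_simps power2_eq_square)
    then show ?thesis using \<open>?c > 0\<close> by simp
  qed
  ultimately show ?thesis by simp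
qed

text \<open>The iteration restricted to an eigenvector with eigenvalue \<open>l > 0\<close>. Eliminating \<open>y\<close> gives a second
  order recurrence for the error \<open>z\<close>, with coefficients \<open>p\<close> and \<open>q\<close>. One of its stability conditions is
  \<open>0 < 1 + q - p = \<omega> \<upsilon> l\<close>; the other two, \<open>q < 1\<close> and \<open>0 < 1 + q + p\<close>, are the two bounds assumed on
  the weights.\<close>

lemma mlspia_mode_convergence:
  fixes x y :: "nat \<Rightarrow> 'a :: real_inner"
  assumes x: "\<And>k. x (Suc k) = x k + y k"
    and y: "\<And>k. y (Suc k) = (1 - \<omega>) *\<^sub>R y k + (\<gamma> * \<upsilon>) *\<^sub>R (g - l *\<^sub>R x (Suc k))
              + ((\<omega> - \<gamma>) * \<upsilon>) *\<^sub>R (g - l *\<^sub>R x k)"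
    and weights: "\<upsilon> > 0" "0 < \<omega>" "(\<omega> - \<gamma>) * \<upsilon> * l < \<omega>" "(2 * \<gamma> - \<omega>) * \<upsilon> * l < 2 * (2 - \<omega>)"
    and l: "l > 0"
  shows "x \<longlonglongrightarrow> (1 / l) *\<^sub>R g"
proof -
  define z where "z k = x k - (1 / l) *\<^sub>R g" for k
  define p q where "p = 2 - \<omega> - \<gamma> * \<upsilon> * l" and "q = 1 - \<omega> - \<gamma> * \<upsilon> * l + \<omega> * \<upsilon> * l"
  have "z (Suc (Suc k)) = p *\<^sub>R z (Suc k) - q *\<^sub>R z k" for k
  proof -
    have "y k = x (Suc k) - x k" by (simp add: x)
    then have "x (Suc (Suc k)) = x (Suc k) + ((1 - \<omega>) *\<^sub>R (x (Suc k) - x k)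
        + (\<gamma> * \<upsilon>) *\<^sub>R (g - l *\<^sub>R x (Suc k)) + ((\<omega> - \<gamma>) * \<upsilon>) *\<^sub>R (g - l *\<^sub>R x k))"
      by (simp only: x[of "Suc k"] y)
    moreover have "x j = z j + (1 / l) *\<^sub>R g" for j by (simp add: z_def)
    ultimately show ?thesis
      using l by (simp add: p_def q_def algebra_simps scaleR_2)
  qed
  moreover have "0 < \<omega> * \<upsilon> * l" using weights l by simp
  then have "\<bar>p\<bar> < 1 + q" "q < 1"
    using weights unfolding p_def q_def abs_less_iff by (auto simp: algebra_simps)
  ultimately have "z \<longlonglongrightarrow> 0"
    by (rule second_order_recurrence_tendsto_zero)
  then show ?thesis unfolding z_def by (simp add: LIM_zero_iff)
qed

text \<open>The residual of a solution \<open>L\<close> of the normal equations is orthogonal to the range of \<open>N\<close>, so the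
  squared residual of \<open>P\<close> is that of \<open>L\<close> plus \<open>\<parallel>N (L - P)\<parallel>\<^sup>2\<close>.\<close>

lemma normal_equations_imp_least_squares:
  fixes P L :: "'i \<Rightarrow> 'a :: real_inner" and N :: "'h \<Rightarrow> 'i \<Rightarrow> real"
  assumes normal: "\<And>i. i \<in> I \<Longrightarrow> (\<Sum>h\<in>H. N h i *\<^sub>R (Q h - (\<Sum>j\<in>I. N h j *\<^sub>R L j))) = 0"
  shows "(\<Sum>h\<in>H. (norm (Q h - (\<Sum>j\<in>I. N h j *\<^sub>R L j)))\<^sup>2) \<le> (\<Sum>h\<in>H. (norm (Q h - (\<Sum>j\<in>I. N h j *\<^sub>R P j)))\<^sup>2)"
proof -
  define R where "R h = Q h - (\<Sum>j\<in>I. N h j *\<^sub>R L j)" for h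
  define E where "E h = (\<Sum>j\<in>I. N h j *\<^sub>R (L j - P j))" for h
  have "(\<Sum>h\<in>H. inner (R h) (E h)) = (\<Sum>h\<in>H. \<Sum>j\<in>I. inner (N h j *\<^sub>R R h) (L j - P j))"
    unfolding E_def by (simp add: inner_sum_right)
  also have "\<dots> = (\<Sum>j\<in>I. inner (\<Sum>h\<in>H. N h j *\<^sub>R R h) (L j - P j))"
    by (subst sum.swap) (simp add: inner_sum_left)
  also have "\<dots> = 0"
    by (rule sum.neutral) (use normal in \<open>simp add: R_def\<close>)
  finally have orth: "(\<Sum>h\<in>H. inner (R h) (E h)) = 0" .
  have "Q h - (\<Sum>j\<in>I. N h j *\<^sub>R P j) = R h + E h" for h
    by (simp add: R_def E_def scaleR_diff_right sum_subtractf)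
  then have "(\<Sum>h\<in>H. (norm (Q h - (\<Sum>j\<in>I. N h j *\<^sub>R P j)))\<^sup>2)
      = (\<Sum>h\<in>H. (norm (R h))\<^sup>2 + (norm (E h))\<^sup>2 + 2 * inner (R h) (E h))"
    by (simp add: power2_norm_eq_inner inner_simps inner_commute)
  also have "\<dots> = (\<Sum>h\<in>H. (norm (R h))\<^sup>2) + (\<Sum>h\<in>H. (norm (E h))\<^sup>2)"
    by (simp add: sum.distrib orth flip: sum_distrib_left)
  finally show ?thesis
    by (simp add: R_def sum_nonneg)
qed

text \<open>The columns of \<open>u\<close> form an orthonormal eigenbasis of \<open>N\<^sup>T N\<close> with eigenvalues \<open>l\<close>. The indices range over
  arbitrary sets, so that pairs \<open>(i, j)\<close> of a tensor product are possible indices. Orthonormality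
  is expressed by \<open>u u\<^sup>T = 1\<close>, the form in which coordinates are converted back.\<close>

definition gram_eigenbasis ::
  "'h set \<Rightarrow> 'i set \<Rightarrow> ('h \<Rightarrow> 'i \<Rightarrow> real) \<Rightarrow> ('i \<Rightarrow> 'i \<Rightarrow> real) \<Rightarrow> ('i \<Rightarrow> real) \<Rightarrow> bool" where
  "gram_eigenbasis H I N u l \<longleftrightarrow>
     (\<forall>i\<in>I. \<forall>j\<in>I. (\<Sum>a\<in>I. u i a * u j a) = (if i = j then 1 else 0)) \<and>
     (\<forall>a\<in>I. \<forall>b\<in>I. (\<Sum>h\<in>H. (\<Sum>i\<in>I. N h i * u i a) * (\<Sum>i\<in>I. N h i * u i b)) = (if a = b then l a else 0))"

lemma gram_eigenbasis_nonneg: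
  assumes "gram_eigenbasis H I N u l" and "a \<in> I"
  shows "0 \<le> l a"
proof -
  have "l a = (\<Sum>h\<in>H. (\<Sum>i\<in>I. N h i * u i a) * (\<Sum>i\<in>I. N h i * u i a))"
    using assms unfolding gram_eigenbasis_def by auto
  then show ?thesis by (simp add: sum_nonneg)
qed

text \<open>The squares of the left-hand side sum up to the eigenvalue \<open>l a\<close> over all \<open>h\<close>.\<close>

lemma gram_eigenbasis_kernel:
  assumes basis: "gram_eigenbasis H I N u l" and "finite H" and a: "a \<in> I" "l a = 0" and "h \<in> H"
  shows "(\<Sum>i\<in>I. N h i * u i a) = 0"
proof -
  have "(\<Sum>h\<in>H. (\<Sum>i\<in>I. N h i * u i a) * (\<Sum>i\<in>I. N h i * u i a)) = 0"
    using basis a unfolding gram_eigenbasis_def by auto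
  then show ?thesis
    using assms by (subst (asm) sum_nonneg_eq_0_iff) auto
qed

lemma gram_eigenbasis_zero:
  assumes basis: "gram_eigenbasis H I N u l" and fin: "finite H" "finite I"
    and l: "\<And>a. a \<in> I \<Longrightarrow> l a = 0" and h: "h \<in> H" and j: "j \<in> I"
  shows "N h j = 0"
proof -
  have "N h j = (\<Sum>i\<in>I. if i = j then N h i else 0)"
    using fin j by simp
  also have "\<dots> = (\<Sum>i\<in>I. N h i * (\<Sum>a\<in>I. u i a * u j a))"
    using basis j unfolding gram_eigenbasis_def by (intro sum.cong) auto
  also have "\<dots> = (\<Sum>a\<in>I. u j a * (\<Sum>i\<in>I. N h i * u i a))"
    unfolding sum_distrib_left by (subst sum.swap) (simp add: mult_ac)
  also have "\<dots> = 0"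
    using gram_eigenbasis_kernel[OF basis fin(1) _ _ h] l by simp
  finally show ?thesis .
qed

lemma gram_eigenbasis_product:
  assumes 1: "gram_eigenbasis H1 I1 N1 u1 l1" and 2: "gram_eigenbasis H2 I2 N2 u2 l2"
  shows "gram_eigenbasis (H1 \<times> H2) (I1 \<times> I2) (\<lambda>(h1, h2) (i1, i2). N1 h1 i1 * N2 h2 i2)
           (\<lambda>(i1, i2) (a1, a2). u1 i1 a1 * u2 i2 a2) (\<lambda>(a1, a2). l1 a1 * l2 a2)"
proof -
  have split: "(\<Sum>(x, y)\<in>X \<times> Y. f x * g y) = sum f X * sum g Y" for X :: "'x set" and Y :: "'y set"
    and f g :: "_ \<Rightarrow> real"
    by (simp add: sum_product sum.cartesian_product)
  show ?thesis
    unfolding gram_eigenbasis_def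
  proof (intro conjI ballI)
    fix i j assume "i \<in> I1 \<times> I2" "j \<in> I1 \<times> I2"
    then obtain i1 i2 j1 j2 where ij: "i = (i1, i2)" "j = (j1, j2)" "i1 \<in> I1" "i2 \<in> I2" "j1 \<in> I1" "j2 \<in> I2" by auto
    have "(\<Sum>a\<in>I1 \<times> I2. (case i of (i1, i2) \<Rightarrow> \<lambda>(a1, a2). u1 i1 a1 * u2 i2 a2) a *
            (case j of (i1, i2) \<Rightarrow> \<lambda>(a1, a2). u1 i1 a1 * u2 i2 a2) a) =
          (\<Sum>(a1, a2)\<in>I1 \<times> I2. (u1 i1 a1 * u1 j1 a1) * (u2 i2 a2 * u2 j2 a2))"
      by (rule sum.cong) (auto simp: ij)
    then show "(\<Sum>a\<in>I1 \<times> I2. (case i of (i1, i2) \<Rightarrow> \<lambda>(a1, a2). u1 i1 a1 * u2 i2 a2) a *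
            (case j of (i1, i2) \<Rightarrow> \<lambda>(a1, a2). u1 i1 a1 * u2 i2 a2) a) = (if i = j then 1 else 0)"
      using 1 2 ij unfolding split gram_eigenbasis_def by auto
  next
    fix a b assume "a \<in> I1 \<times> I2" "b \<in> I1 \<times> I2"
    then obtain a1 a2 b1 b2 where ab: "a = (a1, a2)" "b = (b1, b2)" "a1 \<in> I1" "a2 \<in> I2" "b1 \<in> I1" "b2 \<in> I2" by auto
    define K where "K h c = (\<Sum>i\<in>I1 \<times> I2. (case h of (h1, h2) \<Rightarrow> \<lambda>(i1, i2). N1 h1 i1 * N2 h2 i2) i *
            (case i of (i1, i2) \<Rightarrow> \<lambda>(a1, a2). u1 i1 a1 * u2 i2 a2) c)" for h c
    have K: "K (h1, h2) (c1, c2) = (\<Sum>i\<in>I1. N1 h1 i * u1 i c1) * (\<Sum>i\<in>I2. N2 h2 i * u2 i c2)" for h1 h2 c1 c2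
      unfolding split[symmetric] K_def by (rule sum.cong) auto
    have "(\<Sum>h\<in>H1 \<times> H2. K h a * K h b) =
       (\<Sum>(h1, h2)\<in>H1 \<times> H2. ((\<Sum>i\<in>I1. N1 h1 i * u1 i a1) * (\<Sum>i\<in>I1. N1 h1 i * u1 i b1)) *
          ((\<Sum>i\<in>I2. N2 h2 i * u2 i a2) * (\<Sum>i\<in>I2. N2 h2 i * u2 i b2)))"
      by (rule sum.cong) (auto simp: ab K)
    then have "(\<Sum>h\<in>H1 \<times> H2. K h a * K h b) = (if a = b then case a of (a1, a2) \<Rightarrow> l1 a1 * l2 a2 else 0)"
      using 1 2 ab unfolding split gram_eigenbasis_def by auto
    then show "(\<Sum>h\<in>H1 \<times> H2.
       (\<Sum>i\<in>I1 \<times> I2. (case h of (h1, h2) \<Rightarrow> \<lambda>(i1, i2). N1 h1 i1 * N2 h2 i2) i *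
            (case i of (i1, i2) \<Rightarrow> \<lambda>(a1, a2). u1 i1 a1 * u2 i2 a2) a) *
       (\<Sum>i\<in>I1 \<times> I2. (case h of (h1, h2) \<Rightarrow> \<lambda>(i1, i2). N1 h1 i1 * N2 h2 i2) i *
            (case i of (i1, i2) \<Rightarrow> \<lambda>(a1, a2). u1 i1 a1 * u2 i2 a2) b)) =
      (if a = b then case a of (a1, a2) \<Rightarrow> l1 a1 * l2 a2 else 0)"
      unfolding K_def .
  qed
qed

text \<open>MLSPIA for an arbitrary collocation matrix \<open>N\<close>. In the coordinates \<open>T\<close> with respect to the eigenbasis
  the iteration decouples into one recurrence for each eigenvalue. For positive eigenvalues the
  coordinates converge by \<open>mlspia_mode_convergence\<close>. For the eigenvalue zero the
  residuals contribute nothing, and neither does the initial direction, because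
  it lies in the range of \<open>N\<^sup>T\<close>; so these coordinates keep their initial values. The limit satisfies the
  normal equations coordinate by coordinate.\<close>

lemma mlspia_converges:
  fixes P \<Delta> :: "nat \<Rightarrow> 'i \<Rightarrow> 'a :: real_inner" and N :: "'h \<Rightarrow> 'i \<Rightarrow> real"
  assumes fin: "finite I" "finite H" and basis: "gram_eigenbasis H I N u l"
    and P: "\<And>k i. i \<in> I \<Longrightarrow> P (Suc k) i = P k i + \<Delta> k i"
    and \<delta>: "\<And>k i. i \<in> I \<Longrightarrow> \<delta> k i = \<upsilon> *\<^sub>R (\<Sum>h\<in>H. N h i *\<^sub>R (Q h - (\<Sum>j\<in>I. N h j *\<^sub>R P k j)))"
    and \<Delta>0: "\<And>i. i \<in> I \<Longrightarrow> \<Delta> 0 i = \<upsilon> *\<^sub>R (\<Sum>h\<in>H. N h i *\<^sub>R \<Lambda> h)"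
    and \<Delta>: "\<And>k i. i \<in> I \<Longrightarrow> \<Delta> (Suc k) i = (1 - \<omega>) *\<^sub>R \<Delta> k i + \<gamma> *\<^sub>R \<delta> (Suc k) i + (\<omega> - \<gamma>) *\<^sub>R \<delta> k i"
    and weights: "\<upsilon> > 0" "0 < \<omega>"
    and stable: "\<And>a. a \<in> I \<Longrightarrow> (\<omega> - \<gamma>) * \<upsilon> * l a < \<omega>"
      "\<And>a. a \<in> I \<Longrightarrow> (2 * \<gamma> - \<omega>) * \<upsilon> * l a < 2 * (2 - \<omega>)"
  shows "\<exists>L. (\<forall>i\<in>I. (\<lambda>k. P k i) \<longlonglongrightarrow> L i) \<and>
           (\<forall>i\<in>I. (\<Sum>h\<in>H. N h i *\<^sub>R (Q h - (\<Sum>j\<in>I. N h j *\<^sub>R L j))) = 0)"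
proof -
  define c where "c h a = (\<Sum>i\<in>I. N h i * u i a)" for h a
  define T where "T X a = (\<Sum>i\<in>I. u i a *\<^sub>R X i)" for X :: "'i \<Rightarrow> 'a" and a
  define g where "g a = (\<Sum>h\<in>H. c h a *\<^sub>R Q h)" for a
  have complete: "(\<Sum>a\<in>I. u i a * u j a) = (if i = j then 1 else 0)" if "i \<in> I" "j \<in> I" for i j
    using basis that unfolding gram_eigenbasis_def by auto
  have gram: "(\<Sum>h\<in>H. c h a * c h b) = (if a = b then l a else 0)" if "a \<in> I" "b \<in> I" for a b
    using basis that unfolding gram_eigenbasis_def c_def by auto
  have inverse: "(\<Sum>a\<in>I. u i a *\<^sub>R T X a) = X i" if "i \<in> I" for X i
  proof -
    have "(\<Sum>a\<in>I. u i a *\<^sub>R T X a) = (\<Sum>a\<in>I. \<Sum>j\<in>I. (u i a * u j a) *\<^sub>R X j)"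
      unfolding T_def scaleR_sum_right by simp
    also have "\<dots> = (\<Sum>j\<in>I. (\<Sum>a\<in>I. u i a * u j a) *\<^sub>R X j)"
      by (subst sum.swap) (simp add: scaleR_sum_left)
    also have "\<dots> = (\<Sum>j\<in>I. if j = i then X j else 0)"
      using that by (intro sum.cong) (auto simp: complete)
    finally show ?thesis using fin that by simp
  qed
  have T_weighted: "T (\<lambda>i. \<Sum>h\<in>H. N h i *\<^sub>R Y h) a = (\<Sum>h\<in>H. c h a *\<^sub>R Y h)" for Y a
    unfolding T_def c_def scaleR_sum_right scaleR_sum_left
    by (subst sum.swap) (simp add: mult.commute)
  have surface: "(\<Sum>j\<in>I. N h j *\<^sub>R X j) = (\<Sum>a\<in>I. c h a *\<^sub>R T X a)" for X h
  proof -
    have "(\<Sum>j\<in>I. N h j *\<^sub>R X j) = (\<Sum>j\<in>I. N h j *\<^sub>R (\<Sum>a\<in>I. u j a *\<^sub>R T X a))"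
      by (rule sum.cong) (auto simp: inverse)
    also have "\<dots> = (\<Sum>a\<in>I. c h a *\<^sub>R T X a)"
      unfolding c_def scaleR_sum_right scaleR_sum_left by (subst sum.swap) simp
    finally show ?thesis .
  qed
  have T_residual: "T (\<lambda>i. \<Sum>h\<in>H. N h i *\<^sub>R (Q h - (\<Sum>j\<in>I. N h j *\<^sub>R X j))) a = g a - l a *\<^sub>R T X a"
    if "a \<in> I" for X a
  proof -
    have "(\<Sum>h\<in>H. c h a *\<^sub>R (\<Sum>b\<in>I. c h b *\<^sub>R T X b)) = (\<Sum>b\<in>I. (\<Sum>h\<in>H. c h a * c h b) *\<^sub>R T X b)"
      unfolding scaleR_sum_right scaleR_sum_left by (subst sum.swap) simp
    also have "\<dots> = (\<Sum>b\<in>I. if b = a then l a *\<^sub>R T X b else 0)"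
      using that by (intro sum.cong) (auto simp: gram)
    also have "\<dots> = l a *\<^sub>R T X a" using fin that by simp
    finally show ?thesis
      unfolding T_weighted surface g_def by (simp add: scaleR_diff_right sum_subtractf)
  qed
  have T_add: "T (\<lambda>i. X i + Y i) a = T X a + T Y a" and T_scale: "T (\<lambda>i. r *\<^sub>R X i) a = r *\<^sub>R T X a" for X Y a r
    unfolding T_def by (simp_all add: scaleR_add_right sum.distrib scaleR_sum_right mult.commute)
  have T_cong: "T X a = T Y a" if "\<And>i. i \<in> I \<Longrightarrow> X i = Y i" for X Y a
    unfolding T_def using that by (intro sum.cong) auto
  have kernel: "c h a = 0" if "a \<in> I" "l a = 0" "h \<in> H" for h a
    using gram_eigenbasis_kernel[OF basis fin(2) that] unfolding c_def .
  have T\<delta>: "T (\<delta> k) a = \<upsilon> *\<^sub>R (g a - l a *\<^sub>R T (P k) a)" if "a \<in> I" for k a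
    using that by (simp add: T_cong[OF \<delta>] T_scale T_residual)
  have TP: "T (P (Suc k)) a = T (P k) a + T (\<Delta> k) a" for k a
    by (simp add: T_cong[OF P] T_add)
  have T\<Delta>: "T (\<Delta> (Suc k)) a = (1 - \<omega>) *\<^sub>R T (\<Delta> k) a + \<gamma> *\<^sub>R T (\<delta> (Suc k)) a + (\<omega> - \<gamma>) *\<^sub>R T (\<delta> k) a" for k a
    by (simp add: T_cong[OF \<Delta>] T_add T_scale)
  have T\<Delta>0: "T (\<Delta> 0) a = \<upsilon> *\<^sub>R (\<Sum>h\<in>H. c h a *\<^sub>R \<Lambda> h)" for a
    by (simp add: T_cong[OF \<Delta>0] T_scale T_weighted)
  \<comment> \<open>The kernel components of the limit are those of the initial control points.\<close>
  define M where "M a = (if l a = 0 then T (P 0) a else (1 / l a) *\<^sub>R g a)" for a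
  have mode: "(\<lambda>k. T (P k) a) \<longlonglongrightarrow> M a" if a: "a \<in> I" for a
  proof (cases "l a = 0")
    case True
    have g0: "g a = 0" unfolding g_def using kernel[OF a True] by simp
    have "T (\<Delta> k) a = 0" for k
      by (induction k) (use kernel[OF a True] a in \<open>simp_all add: T\<Delta>0 T\<Delta> T\<delta> True g0\<close>)
    then have "T (P k) a = M a" for k
      by (induction k) (simp_all add: TP M_def True)
    then show ?thesis by simp
  next
    case False
    then have l: "l a > 0" using gram_eigenbasis_nonneg[OF basis a] by simp
    have "(\<lambda>k. T (P k) a) \<longlonglongrightarrow> (1 / l a) *\<^sub>R g a"
      by (rule mlspia_mode_convergence[where y = "\<lambda>k. T (\<Delta> k) a", OF TP _ weights stable(1)[OF a] stable(2)[OF a] l])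
        (use a in \<open>simp add: T\<Delta> T\<delta>\<close>)
    then show ?thesis by (simp add: M_def False)
  qed
  define L where "L i = (\<Sum>a\<in>I. u i a *\<^sub>R M a)" for i
  have lim: "(\<lambda>k. P k i) \<longlonglongrightarrow> L i" if "i \<in> I" for i
  proof -
    have "(\<lambda>k. \<Sum>a\<in>I. u i a *\<^sub>R T (P k) a) \<longlonglongrightarrow> L i"
      unfolding L_def by (intro tendsto_intros mode)
    then show ?thesis using that by (simp add: inverse)
  qed
  have TL: "T L a = M a" if "a \<in> I" for a
  proof -
    have "(\<lambda>k. T (P k) a) \<longlonglongrightarrow> T L a"
      unfolding T_def by (intro tendsto_intros lim)
    then show ?thesis using mode[OF that] LIMSEQ_unique by blast
  qed
  have "(\<Sum>h\<in>H. N h i *\<^sub>R (Q h - (\<Sum>j\<in>I. N h j *\<^sub>R L j))) = 0" if i: "i \<in> I" for i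
  proof -
    have "g a - l a *\<^sub>R T L a = 0" if "a \<in> I" for a
      using kernel[OF that] by (auto simp: TL[OF that] M_def g_def)
    then show ?thesis
      by (subst inverse[OF i, symmetric]) (simp add: T_residual)
  qed
  with lim show ?thesis by blast
qed

section \<open>The spectral radius of the iteration matrix\<close>

lemma H_hat_carrier:
  "H_hat M R (mat_diag R f) \<omega> \<gamma> \<upsilon> \<in> carrier_mat (R + (M - R) + R) (R + (M - R) + R)"
  unfolding H_hat_def append_rows_def by (auto simp: mat_diag_def)

text \<open>Row \<open>i\<close> of the first block couples the coordinates \<open>i\<close> and \<open>R + (M - R) + i\<close> only, and so does the row
  \<open>R + (M - R) + i\<close>; the middle block is a multiple of the identity. Hence the matrix is, up to a
  permutation of the coordinates, a direct sum of blocks of size two and one.\<close>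

lemma H_hat_mult_vec:
  fixes z :: "complex vec"
  assumes z: "z \<in> carrier_vec (R + (M - R) + R)" and i: "i < R + (M - R) + R"
  shows "(map_mat complex_of_real (H_hat M R (mat_diag R f) \<omega> \<gamma> \<upsilon>) *\<^sub>v z) $ i =
    (if i < R then of_real (1 - \<omega> - \<gamma> * \<upsilon> * (f i)\<^sup>2) * z $ i - of_real (\<omega> * f i) * z $ (R + (M - R) + i)
     else if i < R + (M - R) then of_real (1 - \<omega>) * z $ i
     else of_real (\<upsilon> * f (i - (R + (M - R)))) * z $ (i - (R + (M - R))) + z $ i)"
proof -
  define N where "N = M - R"
  define H where "H = H_hat M R (mat_diag R f) \<omega> \<gamma> \<upsilon>"
  have H_def': "H = four_block_mat
       (four_block_mat
         ((1 - \<omega>) \<cdot>\<^sub>m 1\<^sub>m R - (\<gamma> * \<upsilon>) \<cdot>\<^sub>m mat_diag R (\<lambda>i. f i * f i)) (0\<^sub>m R N)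
         (0\<^sub>m N R) ((1 - \<omega>) \<cdot>\<^sub>m 1\<^sub>m N))
       (four_block_mat ((- \<omega>) \<cdot>\<^sub>m mat_diag R f) (0\<^sub>m R 0) (0\<^sub>m N R) (0\<^sub>m N 0))
       (four_block_mat (\<upsilon> \<cdot>\<^sub>m mat_diag R f) (0\<^sub>m R N) (0\<^sub>m 0 R) (0\<^sub>m 0 N))
       (1\<^sub>m R)"
    unfolding H_def H_hat_def append_rows_def N_def[symmetric]
    by (simp add: carrier_matD[OF mat_diag_dim])
  have H: "H \<in> carrier_mat (R + N + R) (R + N + R)"
    unfolding H_def N_def by (rule H_hat_carrier)
  have row: "(map_mat complex_of_real H *\<^sub>v z) $ i = (\<Sum>j<R + N + R. of_real (H $$ (i, j)) * z $ j)"
    if "i < R + N + R" for i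
    using that z H unfolding N_def[symmetric]
    by (auto simp: scalar_prod_def atLeast0LessThan intro!: sum.cong)
  consider (top) "i < R" | (mid) i' where "i = R + i'" "i' < N" | (bot) i' where "i = R + N + i'" "i' < R"
    using i unfolding N_def[symmetric] by (metis add_less_cancel_left le_add_diff_inverse not_less)
  then show ?thesis
    unfolding N_def[symmetric] H_def[symmetric]
  proof cases
    case top
    have "H $$ (i, j) = (if j = i then 1 - \<omega> - \<gamma> * \<upsilon> * (f i)\<^sup>2 else 0) + (if j = R + N + i then - (\<omega> * f i) else 0)"
      if j: "j < R + N + R" for j
    proof -
      consider "j < R" | "\<not> j < R" "j < R + N" | j' where "j = R + N + j'" "j' < R"
        using j by (metis add_less_cancel_left le_add_diff_inverse not_less)
      then show ?thesis
        using top by cases (auto simp: H_def' mat_diag_def power2_eq_square)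
    qed
    then have "(\<Sum>j<R + N + R. of_real (H $$ (i, j)) * z $ j)
      = (\<Sum>j<R + N + R. (if j = i then of_real (1 - \<omega> - \<gamma> * \<upsilon> * (f i)\<^sup>2) * z $ j else 0)
          + (if j = R + N + i then - of_real (\<omega> * f i) * z $ j else 0))"
      using top by (intro sum.cong) auto
    also have "\<dots> = of_real (1 - \<omega> - \<gamma> * \<upsilon> * (f i)\<^sup>2) * z $ i - of_real (\<omega> * f i) * z $ (R + N + i)"
      using top by (simp only: sum.distrib) simp
    finally show "(map_mat complex_of_real H *\<^sub>v z) $ i = (if i < R then of_real (1 - \<omega> - \<gamma> * \<upsilon> * (f i)\<^sup>2) * z $ i - of_real (\<omega> * f i) * z $ (R + N + i)
     else if i < R + N then of_real (1 - \<omega>) * z $ i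
     else of_real (\<upsilon> * f (i - (R + N))) * z $ (i - (R + N)) + z $ i)"
      using row[of i] top by simp
  next
    case mid
    have "H $$ (i, j) = (if j = i then 1 - \<omega> else 0)" if j: "j < R + N + R" for j
    proof -
      consider "j < R" | "\<not> j < R" "j < R + N" | j' where "j = R + N + j'" "j' < R"
        using j by (metis add_less_cancel_left le_add_diff_inverse not_less)
      then show ?thesis
        using mid by cases (auto simp: H_def' mat_diag_def power2_eq_square)
    qed
    then have "(\<Sum>j<R + N + R. of_real (H $$ (i, j)) * z $ j)
      = (\<Sum>j<R + N + R. (if j = i then of_real (1 - \<omega>) * z $ j else 0))"
      by (intro sum.cong) auto
    also have "\<dots> = of_real (1 - \<omega>) * z $ i"
      using mid by simp
    finally show "(map_mat complex_of_real H *\<^sub>v z) $ i = (if i < R then of_real (1 - \<omega> - \<gamma> * \<upsilon> * (f i)\<^sup>2) * z $ i - of_real (\<omega> * f i) * z $ (R + N + i)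
     else if i < R + N then of_real (1 - \<omega>) * z $ i
     else of_real (\<upsilon> * f (i - (R + N))) * z $ (i - (R + N)) + z $ i)"
      using row[of i] mid by simp
  next
    case bot
    have "H $$ (i, j) = (if j = i' then \<upsilon> * f i' else 0) + (if j = i then 1 else 0)" if j: "j < R + N + R" for j
    proof -
      consider "j < R" | "\<not> j < R" "j < R + N" | j' where "j = R + N + j'" "j' < R"
        using j by (metis add_less_cancel_left le_add_diff_inverse not_less)
      then show ?thesis
        using bot by cases (auto simp: H_def' mat_diag_def power2_eq_square)
    qed
    then have "(\<Sum>j<R + N + R. of_real (H $$ (i, j)) * z $ j)
      = (\<Sum>j<R + N + R. (if j = i' then of_real (\<upsilon> * f i') * z $ j else 0) + (if j = i then z $ j else 0))"
      using bot by (intro sum.cong) auto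
    also have "\<dots> = of_real (\<upsilon> * f i') * z $ i' + z $ i"
      using bot by (simp only: sum.distrib) simp
    finally show "(map_mat complex_of_real H *\<^sub>v z) $ i = (if i < R then of_real (1 - \<omega> - \<gamma> * \<upsilon> * (f i)\<^sup>2) * z $ i - of_real (\<omega> * f i) * z $ (R + N + i)
     else if i < R + N then of_real (1 - \<omega>) * z $ i
     else of_real (\<upsilon> * f (i - (R + N))) * z $ (i - (R + N)) + z $ i)"
      using row[of i] bot by simp
  qed
qed

text \<open>The quadratic is the characteristic polynomial of the two by two block that belongs to the
  singular value \<open>f i\<close>, and \<open>1 - \<omega>\<close> is the eigenvalue of the middle block. An eigenvector has a nonzero
  coordinate in one of the blocks, which decides the case.\<close>

lemma H_hat_eigenvalue_cases:
  assumes ev: "eigenvalue (map_mat complex_of_real (H_hat M R (mat_diag R f) \<omega> \<gamma> \<upsilon>)) k"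
    and f: "\<And>i. i < R \<Longrightarrow> f i \<noteq> 0" and \<upsilon>: "\<upsilon> \<noteq> 0"
  shows "k = of_real (1 - \<omega>) \<or>
    (\<exists>i<R. k\<^sup>2 - of_real (2 - \<omega> - \<gamma> * \<upsilon> * (f i)\<^sup>2) * k
             + of_real (1 - \<omega> - \<gamma> * \<upsilon> * (f i)\<^sup>2 + \<omega> * \<upsilon> * (f i)\<^sup>2) = 0)"
proof -
  let ?K = "R + (M - R)"
  obtain z where z: "z \<in> carrier_vec (?K + R)" "z \<noteq> 0\<^sub>v (?K + R)"
    and eq: "map_mat complex_of_real (H_hat M R (mat_diag R f) \<omega> \<gamma> \<upsilon>) *\<^sub>v z = k \<cdot>\<^sub>v z"
    using ev H_hat_carrier[of M R f \<omega> \<gamma> \<upsilon>] unfolding eigenvalue_def eigenvector_def by auto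
  have row: "k * z $ i =
    (if i < R then of_real (1 - \<omega> - \<gamma> * \<upsilon> * (f i)\<^sup>2) * z $ i - of_real (\<omega> * f i) * z $ (?K + i)
     else if i < ?K then of_real (1 - \<omega>) * z $ i
     else of_real (\<upsilon> * f (i - ?K)) * z $ (i - ?K) + z $ i)" if "i < ?K + R" for i
    unfolding H_hat_mult_vec[OF z(1) that, symmetric] eq using that z(1) by simp
  obtain i where i: "i < ?K + R" "z $ i \<noteq> 0"
    using z by (metis eq_vecI carrier_vecD index_zero_vec)
  show ?thesis
  proof (cases "R \<le> i \<and> i < ?K")
    case True
    then show ?thesis using row[OF i(1)] i(2) by simp
  next
    case False
    \<comment> \<open>\<open>p\<close> is the number of the two by two block that contains the nonzero coordinate \<open>i\<close>.\<close>
    define p where "p = (if i < R then i else i - ?K)"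
    have p: "p < R" using False i unfolding p_def by auto
    define a b where "a = z $ p" and "b = z $ (?K + p)"
    have ab: "a \<noteq> 0 \<or> b \<noteq> 0" using False i unfolding a_def b_def p_def by (auto split: if_splits)
    let ?c = "complex_of_real (1 - \<omega> - \<gamma> * \<upsilon> * (f p)\<^sup>2)"
    have 1: "k * a = ?c * a - of_real (\<omega> * f p) * b"
      using row[of p] p by (simp add: a_def b_def)
    have 2: "k * b = of_real (\<upsilon> * f p) * a + b"
      using row[of "?K + p"] p by (simp add: a_def b_def)
    have nz: "complex_of_real (\<upsilon> * f p) \<noteq> 0" using f[OF p] \<upsilon> by simp
    have "b \<noteq> 0" using ab 2 nz by auto
    have "of_real (\<upsilon> * f p) * a = (k - 1) * b" using 2 by (simp add: algebra_simps)
    moreover have "(k - ?c) * (of_real (\<upsilon> * f p) * a) = - (of_real (\<omega> * \<upsilon> * (f p)\<^sup>2) * b)"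
      using arg_cong[OF 1, of "\<lambda>x. of_real (\<upsilon> * f p) * x"] by (simp add: algebra_simps power2_eq_square)
    ultimately have "(k - ?c) * ((k - 1) * b) + of_real (\<omega> * \<upsilon> * (f p)\<^sup>2) * b = 0"
      by simp
    then have "((k - ?c) * (k - 1) + of_real (\<omega> * \<upsilon> * (f p)\<^sup>2)) * b = 0"
      by (simp only: distrib_right mult.assoc)
    then have "(k - ?c) * (k - 1) + of_real (\<omega> * \<upsilon> * (f p)\<^sup>2) = 0"
      using \<open>b \<noteq> 0\<close> by simp
    then have "k\<^sup>2 - of_real (2 - \<omega> - \<gamma> * \<upsilon> * (f p)\<^sup>2) * k
             + of_real (1 - \<omega> - \<gamma> * \<upsilon> * (f p)\<^sup>2 + \<omega> * \<upsilon> * (f p)\<^sup>2) = 0"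
      by (simp add: algebra_simps power2_eq_square)
    then show ?thesis using p by blast
  qed
qed

text \<open>The eigenvector lives on the two by two block with index 0.\<close>

lemma H_hat_eigenvalue_exists:
  assumes R: "0 < R" and f: "f 0 \<noteq> 0" and \<upsilon>: "\<upsilon> \<noteq> 0"
    and k: "k\<^sup>2 - of_real (2 - \<omega> - \<gamma> * \<upsilon> * (f 0)\<^sup>2) * k
             + of_real (1 - \<omega> - \<gamma> * \<upsilon> * (f 0)\<^sup>2 + \<omega> * \<upsilon> * (f 0)\<^sup>2) = 0"
  shows "eigenvalue (map_mat complex_of_real (H_hat M R (mat_diag R f) \<omega> \<gamma> \<upsilon>)) k"
proof -
  let ?K = "R + (M - R)" and ?H = "map_mat complex_of_real (H_hat M R (mat_diag R f) \<omega> \<gamma> \<upsilon>)"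
  define z where "z = Matrix.vec (?K + R) (\<lambda>i. if i = 0 then k - 1 else if i = ?K then of_real (\<upsilon> * f 0) else 0)"
  have z: "z \<in> carrier_vec (?K + R)" unfolding z_def by simp
  have "z $ ?K \<noteq> 0" using R f \<upsilon> unfolding z_def by simp
  then have "z \<noteq> 0\<^sub>v (?K + R)" using R by auto
  moreover have "?H *\<^sub>v z = k \<cdot>\<^sub>v z"
  proof (rule eq_vecI)
    fix i assume "i < dim_vec (k \<cdot>\<^sub>v z)"
    then have i: "i < ?K + R" using z by simp
    have "of_real (1 - \<omega> - \<gamma> * \<upsilon> * (f 0)\<^sup>2) * (k - 1) - of_real (\<omega> * f 0) * of_real (\<upsilon> * f 0) = k * (k - 1)"
      using k by (simp add: algebra_simps power2_eq_square)
    moreover have "i - ?K = 0 \<longleftrightarrow> i = ?K" if "?K \<le> i" using that by auto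
    ultimately show "(?H *\<^sub>v z) $ i = (k \<cdot>\<^sub>v z) $ i"
      unfolding H_hat_mult_vec[OF z i] using i R by (auto simp: z_def algebra_simps)
  qed (use z H_hat_carrier[of M R f \<omega> \<gamma> \<upsilon>] in auto)
  ultimately show ?thesis
    using z H_hat_carrier[of M R f \<omega> \<gamma> \<upsilon>] unfolding eigenvalue_def eigenvector_def by auto
qed

text \<open>With a nonpositive discriminant the roots are complex conjugate (or equal), so their product \<open>q\<close> is
  the squared modulus of each.\<close>

lemma real_quadratic_root_norm:
  fixes k :: complex and p q :: real
  assumes k: "k\<^sup>2 - of_real p * k + of_real q = 0" and disc: "p\<^sup>2 \<le> 4 * q"
  shows "(cmod k)\<^sup>2 = q"
proof -
  have re: "(Re k)\<^sup>2 - (Im k)\<^sup>2 - p * Re k + q = 0"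
    using arg_cong[OF k, of Re] by (simp add: Re_power2)
  have "2 * Re k * Im k - p * Im k = 0"
    using arg_cong[OF k, of Im] by (simp add: Im_power2)
  then have im: "Im k * (2 * Re k - p) = 0"
    by (simp only: right_diff_distrib mult_ac)
  show ?thesis
  proof (cases "Im k = 0")
    case True
    then have "(2 * Re k - p)\<^sup>2 = p\<^sup>2 - 4 * q" using re by (simp add: power2_eq_square algebra_simps)
    then have "(2 * Re k - p)\<^sup>2 = 0" using disc zero_le_power2[of "2 * Re k - p"] by linarith
    then have "p = 2 * Re k" by simp
    then show ?thesis using re True unfolding cmod_power2 by (simp add: power2_eq_square)
  next
    case False
    then have "p = 2 * Re k" using im by simp
    then show ?thesis using re unfolding cmod_power2 by (simp add: power2_eq_square)
  qed
qed

lemma real_quadratic_root_exists: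
  fixes p q :: real
  assumes "p\<^sup>2 \<le> 4 * q"
  shows "\<exists>k. k\<^sup>2 - complex_of_real p * k + complex_of_real q = 0"
proof
  let ?k = "Complex (p / 2) (sqrt (q - p\<^sup>2 / 4))"
  have "(sqrt (q - p\<^sup>2 / 4))\<^sup>2 = q - p\<^sup>2 / 4" using assms by simp
  then show "?k\<^sup>2 - complex_of_real p * ?k + complex_of_real q = 0"
    by (simp add: complex_eq_iff Re_power2 Im_power2) (simp add: power2_eq_square)
qed

text \<open>At these weights the constant coefficient of every quadratic is \<open>1 - \<omega> = \<rho>\<^sup>2\<close>, and the sum
  \<open>p x\<close> of its roots decreases from \<open>2 \<rho>\<close> at \<open>x = b\<close> to \<open>- 2 \<rho>\<close> at \<open>x = a\<close>. So no
  discriminant is positive, and all roots have modulus \<open>\<rho>\<close>, wherever the singular values lie in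
  the interval. The remaining candidate \<open>1 - \<omega> = \<rho>\<^sup>2\<close> is at most \<open>\<rho>\<close>.\<close>

lemma H_hat_optimal_spectral_radius:
  fixes a b :: real and f :: "nat \<Rightarrow> real"
  assumes R: "0 < R" and b: "0 < b" "b \<le> a" and f: "\<And>i. i < R \<Longrightarrow> f i \<in> {b..a}"
  defines "\<omega> \<equiv> 4 * a * b / (a + b)\<^sup>2" and "\<upsilon> \<equiv> 1 / (a * b)"
  shows "convergence_rate M R (mat_diag R f) \<omega> \<omega> \<upsilon> = (a - b) / (a + b)"
proof -
  let ?H = "map_mat complex_of_real (H_hat M R (mat_diag R f) \<omega> \<omega> \<upsilon>)"
  define \<rho> where "\<rho> = (a - b) / (a + b)"
  define p where "p x = 2 - \<omega> - \<omega> * \<upsilon> * x\<^sup>2" for x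
  have pos: "a > 0" "a + b > 0" "\<upsilon> \<noteq> 0" using b unfolding \<upsilon>_def by auto
  have \<rho>: "0 \<le> \<rho>" "\<rho> \<le> 1" using b pos unfolding \<rho>_def by (auto simp: divide_simps)
  have \<omega>: "1 - \<omega> = \<rho>\<^sup>2"
  proof -
    have "1 - \<omega> = ((a + b)\<^sup>2 - 4 * a * b) / (a + b)\<^sup>2"
      using pos unfolding \<omega>_def by (simp add: diff_divide_distrib)
    also have "(a + b)\<^sup>2 - 4 * a * b = (a - b)\<^sup>2" by (simp add: power2_eq_square algebra_simps)
    finally show ?thesis unfolding \<rho>_def by (simp add: power_divide)
  qed
  have p: "p x = 2 * (a\<^sup>2 + b\<^sup>2 - 2 * x\<^sup>2) / (a + b)\<^sup>2" for x
  proof -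
    have "\<omega> * \<upsilon> = 4 / (a + b)\<^sup>2"
      using pos b unfolding \<omega>_def \<upsilon>_def by simp
    then have "p x = (2 * (a + b)\<^sup>2 - 4 * a * b - 4 * x\<^sup>2) / (a + b)\<^sup>2"
      using pos unfolding p_def by (simp add: \<omega>_def diff_divide_distrib)
    also have "2 * (a + b)\<^sup>2 - 4 * a * b - 4 * x\<^sup>2 = 2 * (a\<^sup>2 + b\<^sup>2 - 2 * x\<^sup>2)" by (simp add: power2_eq_square algebra_simps)
    finally show ?thesis .
  qed
  have disc: "(p (f i))\<^sup>2 \<le> 4 * \<rho>\<^sup>2" if i: "i < R" for i
  proof -
    have "b\<^sup>2 \<le> (f i)\<^sup>2" "(f i)\<^sup>2 \<le> a\<^sup>2" using f[OF i] b by (auto intro!: power_mono)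
    then have "\<bar>a\<^sup>2 + b\<^sup>2 - 2 * (f i)\<^sup>2\<bar> \<le> a\<^sup>2 - b\<^sup>2" by auto
    then have "\<bar>p (f i)\<bar> \<le> 2 * (a\<^sup>2 - b\<^sup>2) / (a + b)\<^sup>2"
      unfolding p by (simp add: abs_mult divide_right_mono)
    also have "a\<^sup>2 - b\<^sup>2 = (a + b) * (a - b)" by (simp add: power2_eq_square algebra_simps)
    also have "2 * ((a + b) * (a - b)) / (a + b)\<^sup>2 = 2 * \<rho>"
      using pos unfolding \<rho>_def by (simp add: power2_eq_square)
    finally have "\<bar>p (f i)\<bar>\<^sup>2 \<le> (2 * \<rho>)\<^sup>2" by (intro power_mono) auto
    then show ?thesis by (simp add: power_mult_distrib)
  qed
  have q: "1 - \<omega> - \<omega> * \<upsilon> * x + \<omega> * \<upsilon> * x = \<rho>\<^sup>2" for x using \<omega> by simp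
  have f_nz: "f i \<noteq> 0" if "i < R" for i using f[OF that] b by auto
  have carrier: "?H \<in> carrier_mat (R + (M - R) + R) (R + (M - R) + R)"
    using H_hat_carrier[of M R f \<omega> \<omega> \<upsilon>] by simp
  have upper: "cmod k \<le> \<rho>" if ev: "eigenvalue ?H k" for k
    using H_hat_eigenvalue_cases[OF ev f_nz pos(3)]
  proof
    assume "k = of_real (1 - \<omega>)"
    then have "cmod k = \<rho>\<^sup>2" using \<omega> by (simp only: norm_of_real) simp
    then show ?thesis using \<rho> by (simp add: power2_eq_square mult_left_le_one_le)
  next
    assume "\<exists>i<R. k\<^sup>2 - of_real (2 - \<omega> - \<omega> * \<upsilon> * (f i)\<^sup>2) * k
             + of_real (1 - \<omega> - \<omega> * \<upsilon> * (f i)\<^sup>2 + \<omega> * \<upsilon> * (f i)\<^sup>2) = 0"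
    then obtain i where i: "i < R" and k: "k\<^sup>2 - of_real (p (f i)) * k + of_real (\<rho>\<^sup>2) = 0"
      unfolding q p_def by blast
    from real_quadratic_root_norm[OF k disc[OF i]] have "cmod k = \<rho>"
      using \<rho> by simp
    then show ?thesis by simp
  qed
  obtain k where k: "k\<^sup>2 - complex_of_real (p (f 0)) * k + complex_of_real (\<rho>\<^sup>2) = 0"
    using real_quadratic_root_exists[OF disc[OF R]] by blast
  have "eigenvalue ?H k"
    by (rule H_hat_eigenvalue_exists[where f = f, OF R f_nz[OF R] pos(3)]) (use k in \<open>simp only: q p_def\<close>)
  moreover have "cmod k = \<rho>"
    using real_quadratic_root_norm[OF k disc[OF R]] \<rho> by simp
  ultimately have "\<rho> \<in> cmod ` spectrum ?H" unfolding spectrum_def by auto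
  moreover have "spectral_radius ?H \<in> cmod ` spectrum ?H"
    by (rule spectral_radius_mem_max(1)[OF carrier]) (use R in simp)
  then have "spectral_radius ?H \<le> \<rho>" using upper unfolding spectrum_def by auto
  ultimately have "spectral_radius ?H = \<rho>"
    using spectral_radius_mem_max(2)[OF carrier] R by (intro antisym) auto
  then show ?thesis unfolding convergence_rate_def \<rho>_def .
qed

section \<open>Tensor product surfaces\<close>

lemma sum_shift_1: "(\<Sum>i\<in>{1..n}. f i) = (\<Sum>i<n. f (Suc i))" for f :: "nat \<Rightarrow> 'x :: comm_monoid_add"
  using sum.atLeast1_atMost_eq[of f n] by simp

lemma collocation_mat_carrier [simp]: "collocation_mat \<phi> n t m \<in> carrier_mat m n"
  unfolding collocation_mat_def by simp

text \<open>The shifts translate between the points and basis functions, which are numbered from 1, and the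
  matrix entries, which are numbered from 0.\<close>

lemma gram_eigenbasis_collocation:
  assumes "diagonalizes_gram (collocation_mat \<phi> n t m) n U d"
  shows "gram_eigenbasis {1..m} {1..n} (\<lambda>h i. \<phi> i (t h)) (\<lambda>i a. U $$ (i - 1, a - 1)) (\<lambda>a. d (a - 1))"
proof -
  define B where "B = collocation_mat \<phi> n t m"
  have B: "B \<in> carrier_mat m n" and B_entry: "\<And>h i. h < m \<Longrightarrow> i < n \<Longrightarrow> B $$ (h, i) = \<phi> (Suc i) (t (Suc h))"
    unfolding B_def collocation_mat_def by simp_all
  have U: "U \<in> carrier_mat n n" and UTU: "transpose_mat U * U = 1\<^sub>m n"
    and diag: "transpose_mat U * (transpose_mat B * B) * U = mat_diag n d"
    using assms unfolding diagonalizes_gram_def B_def by blast+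
  have UT: "transpose_mat U \<in> carrier_mat n n" using U by simp
  have UUT: "U * transpose_mat U = 1\<^sub>m n" using mat_mult_left_right_inverse[OF UT U UTU] .
  have BU: "B * U \<in> carrier_mat m n" using B U by simp
  have BT: "transpose_mat B \<in> carrier_mat n m" using B by simp
  have "transpose_mat (B * U) * (B * U) = transpose_mat U * transpose_mat B * (B * U)"
    by (simp only: transpose_mult[OF B U])
  also have "\<dots> = transpose_mat U * (transpose_mat B * (B * U))"
    using assoc_mult_mat[OF UT BT BU] .
  also have "transpose_mat B * (B * U) = transpose_mat B * B * U"
    using assoc_mult_mat[OF BT B U] by simp
  also have "transpose_mat U * (transpose_mat B * B * U) = transpose_mat U * (transpose_mat B * B) * U"
    using BT B U by (intro assoc_mult_mat[OF UT _ U, symmetric]) auto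
  finally have gram: "transpose_mat (B * U) * (B * U) = mat_diag n d" using diag by simp
  show ?thesis
    unfolding gram_eigenbasis_def
  proof (intro conjI ballI)
    fix i j assume "i \<in> {1..n}" "j \<in> {1..n}"
    then obtain i' j' where ij: "i = Suc i'" "j = Suc j'" "i' < n" "j' < n"
      by (metis Suc_le_D Suc_le_lessD One_nat_def atLeastAtMost_iff)
    have "(\<Sum>a<n. U $$ (i', a) * U $$ (j', a)) = (U * transpose_mat U) $$ (i', j')"
      using U ij by (simp add: scalar_prod_def atLeast0LessThan)
    then show "(\<Sum>a\<in>{1..n}. U $$ (i - 1, a - 1) * U $$ (j - 1, a - 1)) = (if i = j then 1 else 0)"
      unfolding UUT sum_shift_1 using ij by simp
  next
    fix a b assume "a \<in> {1..n}" "b \<in> {1..n}"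
    then obtain a' b' where ab: "a = Suc a'" "b = Suc b'" "a' < n" "b' < n"
      by (metis Suc_le_D Suc_le_lessD One_nat_def atLeastAtMost_iff)
    have c: "(\<Sum>i<n. \<phi> (Suc i) (t (Suc h)) * U $$ (i, c)) = (B * U) $$ (h, c)" if "h < m" "c < n" for h c
      using that B U by (simp add: scalar_prod_def atLeast0LessThan B_entry)
    have "(\<Sum>h<m. W $$ (h, a') * W $$ (h, b')) = (transpose_mat W * W) $$ (a', b')"
      if "W \<in> carrier_mat m n" for W :: "real mat"
      using that ab by (simp add: scalar_prod_def atLeast0LessThan)
    from this[OF BU] have "(\<Sum>h<m. (B * U) $$ (h, a') * (B * U) $$ (h, b')) = (transpose_mat (B * U) * (B * U)) $$ (a', b')" .
    also have "\<dots> = (if a = b then d (a - 1) else 0)"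
      unfolding gram using ab by (simp add: mat_diag_def)
    finally show "(\<Sum>h\<in>{1..m}. (\<Sum>i\<in>{1..n}. \<phi> i (t h) * U $$ (i - 1, a - 1)) *
        (\<Sum>i\<in>{1..n}. \<phi> i (t h) * U $$ (i - 1, b - 1))) = (if a = b then d (a - 1) else 0)"
      unfolding sum_shift_1 using ab by (simp add: c)
  qed
qed

text \<open>Without nonzero singular values the collocation matrix would vanish, whereas its rows sum to one
  because the basis is normalized.\<close>

lemma NTP_singular_values_nonempty:
  assumes "NTP_basis n \<phi>" and "increasing_params m t" and "0 < m"
  shows "nonzero_singular_values (collocation_mat \<phi> n t m) \<noteq> []"
proof
  assume empty: "nonzero_singular_values (collocation_mat \<phi> n t m) = []"
  obtain U d where D: "diagonalizes_gram (collocation_mat \<phi> n t m) n U d"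
    using diagonalizes_gram_exists[OF collocation_mat_carrier] by blast
  have d: "d i = 0" if "i < n" for i
    using set_nonzero_singular_values[OF collocation_mat_carrier D] empty that by auto
  have "\<phi> i (t 1) = 0" if "i \<in> {1..n}" for i
    by (rule gram_eigenbasis_zero[OF gram_eigenbasis_collocation[OF D] _ _ _ _ that])
      (use assms(3) in \<open>auto intro!: d\<close>)
  then have "(\<Sum>i=1..n. \<phi> i (t 1)) = 0" by simp
  moreover have "t 1 \<in> {0..1}"
  proof -
    have "t 1 \<in> t ` {1..m}" using assms(3) by simp
    then show ?thesis using assms(2) unfolding increasing_params_def by blast
  qed
  ultimately show False
    using assms(1) unfolding NTP_basis_def by auto
qed

lemma collocation_singular_values_pos:
  assumes "x \<in> set (nonzero_singular_values (collocation_mat \<phi> n t m))"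
  shows "0 < x"
proof -
  obtain U d where D: "diagonalizes_gram (collocation_mat \<phi> n t m) n U d"
    using diagonalizes_gram_exists[OF collocation_mat_carrier] by blast
  then obtain i where i: "i < n" "d i \<noteq> 0" "x = sqrt (d i)"
    using assms unfolding set_nonzero_singular_values[OF collocation_mat_carrier D] by auto
  have "0 \<le> d (Suc i - 1)"
    by (rule gram_eigenbasis_nonneg[OF gram_eigenbasis_collocation[OF D]]) (use i in auto)
  then show ?thesis using i by simp
qed

lemma descending_list_bounds:
  fixes \<sigma> :: "nat \<Rightarrow> real"
  assumes xs: "map \<sigma> [1..<Suc r] = xs" and sorted: "sorted_wrt (\<ge>) xs" and x: "x \<in> set xs"
  shows "\<sigma> r \<le> x" and "x \<le> \<sigma> 1"
proof -
  have len: "length xs = r" using xs by auto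
  have nth: "xs ! i = \<sigma> (Suc i)" if "i < r" for i
    using that by (auto simp: xs[symmetric] simp del: upt_Suc)
  obtain i where i: "i < r" "x = xs ! i" using x len by (auto simp: in_set_conv_nth)
  have mono: "xs ! k \<le> xs ! j" if "j \<le> k" "k < r" for j k
    using sorted_wrt_nth_less[OF sorted, of j k] that len by (cases "j = k") auto
  show "\<sigma> r \<le> x" using mono[of i "r - 1"] i nth[of "r - 1"] by simp
  show "x \<le> \<sigma> 1" using mono[of 0 i] i nth[of 0] by simp
qed

text \<open>The surface method is MLSPIA for the tensor product of the two collocation matrices, whose
  indices are pairs; the products of eigenvectors of the factors form an eigenbasis. The two bounds
  on \<open>\<gamma>\<close> are the stability conditions for the eigenvalue \<open>a\<^sup>2\<close>, and they imply those for all smaller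
  eigenvalues.\<close>

lemma mlspia_surface_converges:
  fixes Q :: "nat \<Rightarrow> nat \<Rightarrow> real ^ 'd"
  assumes D1: "diagonalizes_gram (collocation_mat \<phi> n1 t m1) n1 U1 d1"
    and D2: "diagonalizes_gram (collocation_mat \<psi> n2 s m2) n2 U2 d2"
    and bound: "\<And>i j. i < n1 \<Longrightarrow> j < n2 \<Longrightarrow> d1 i * d2 j \<le> a\<^sup>2" and a: "a \<noteq> 0"
    and weights: "0 < \<upsilon>" "0 < \<omega>" "\<omega> < 2"
    and \<gamma>: "\<omega> - \<omega> / (a\<^sup>2 * \<upsilon>) < \<gamma>" "\<gamma> < \<omega> / 2 - (\<omega> - 2) / (a\<^sup>2 * \<upsilon>)"
  shows "converges_to_least_square_surface n1 \<phi> n2 \<psi> m1 t m2 s Q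
           (mlspia_points n1 \<phi> n2 \<psi> m1 t m2 s Q \<omega> \<gamma> \<upsilon> P0 \<Lambda>)"
proof -
  define I H where "I = {1..n1} \<times> {1..n2}" and "H = {1..m1} \<times> {1..m2}"
  define N where "N = (\<lambda>(h, l) (i, j). \<phi> i (t h) * \<psi> j (s l))"
  define l where "l = (\<lambda>(i, j). d1 (i - 1) * d2 (j - 1))"
  define u where "u = (\<lambda>(i, j) (a, b). U1 $$ (i - 1, a - 1) * U2 $$ (j - 1, b - 1))"
  have fin: "finite I" "finite H" unfolding I_def H_def by auto
  have basis: "gram_eigenbasis H I N u l"
    unfolding H_def I_def N_def u_def l_def
    by (rule gram_eigenbasis_product[OF gram_eigenbasis_collocation[OF D1] gram_eigenbasis_collocation[OF D2]])
  have surface: "surface n1 \<phi> n2 \<psi> P (t h) (s k) = (\<Sum>p\<in>I. N (h, k) p *\<^sub>R case_prod P p)"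
    for P :: "nat \<Rightarrow> nat \<Rightarrow> real ^ 'd" and h k
    unfolding surface_def I_def N_def sum.cartesian_product by (rule sum.cong) auto
  have weighted: "weighted_sum \<phi> \<psi> m1 t m2 s \<upsilon> X i j = \<upsilon> *\<^sub>R (\<Sum>q\<in>H. N q (i, j) *\<^sub>R case_prod X q)"
    for X :: "nat \<Rightarrow> nat \<Rightarrow> real ^ 'd" and i j
    unfolding weighted_sum_def H_def N_def sum.cartesian_product
    by (rule arg_cong[where f = "\<lambda>x. \<upsilon> *\<^sub>R x"], rule sum.cong) auto
  define it where "it = mlspia n1 \<phi> n2 \<psi> m1 t m2 s Q \<omega> \<gamma> \<upsilon> P0 \<Lambda>"
  define \<delta> where "\<delta> k = (\<lambda>(i, j). mlspia_delta n1 \<phi> n2 \<psi> m1 t m2 s Q \<upsilon> (fst (it k)) i j)" for k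
  have it_fst: "fst (it (Suc k)) = (\<lambda>i j. fst (it k) i j + snd (it k) i j)"
    and it_snd: "snd (it (Suc k)) = (\<lambda>i j. (1 - \<omega>) *\<^sub>R snd (it k) i j + \<gamma> *\<^sub>R \<delta> (Suc k) (i, j) + (\<omega> - \<gamma>) *\<^sub>R \<delta> k (i, j))" for k
    unfolding it_def \<delta>_def by (simp_all add: Let_def case_prod_unfold)
  have small: "0 \<le> l p" "l p \<le> a\<^sup>2" if "p \<in> I" for p
    using gram_eigenbasis_nonneg[OF basis that] that bound unfolding l_def I_def by auto
  have "\<exists>L. (\<forall>i\<in>I. (\<lambda>k. case_prod (fst (it k)) i) \<longlonglongrightarrow> L i) \<and>
           (\<forall>i\<in>I. (\<Sum>h\<in>H. N h i *\<^sub>R (case_prod Q h - (\<Sum>j\<in>I. N h j *\<^sub>R L j))) = 0)"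
  proof (rule mlspia_converges[where \<Delta> = "\<lambda>k. case_prod (snd (it k))" and \<delta> = \<delta> and \<Lambda> = "case_prod \<Lambda>",
        OF fin basis])
    fix p assume "p \<in> I"
    have A: "0 < a\<^sup>2 * \<upsilon>" using a weights by simp
    have mono: "c * \<upsilon> * l p < e" if "c < e / (a\<^sup>2 * \<upsilon>)" "0 < e" for c e
    proof (cases "c \<le> 0")
      case True
      then have "c * \<upsilon> * l p \<le> 0"
        using small[OF \<open>p \<in> I\<close>] weights by (simp add: mult_nonpos_nonneg)
      then show ?thesis using that by simp
    next
      case False
      then have "c * \<upsilon> * l p \<le> c * \<upsilon> * a\<^sup>2"
        using small[OF \<open>p \<in> I\<close>] weights by (intro mult_left_mono) auto
      also have "\<dots> < e" using that(1) A by (simp add: pos_less_divide_eq mult_ac)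
      finally show ?thesis .
    qed
    show "(\<omega> - \<gamma>) * \<upsilon> * l p < \<omega>"
      using \<gamma>(1) weights by (intro mono) auto
    have "(\<gamma> - \<omega> / 2) * \<upsilon> * l p < 2 - \<omega>"
    proof (rule mono)
      have "- ((\<omega> - 2) / (a\<^sup>2 * \<upsilon>)) = (2 - \<omega>) / (a\<^sup>2 * \<upsilon>)"
        by (simp only: minus_divide_left minus_diff_eq)
      then show "\<gamma> - \<omega> / 2 < (2 - \<omega>) / (a\<^sup>2 * \<upsilon>)" using \<gamma>(2) by linarith
    qed (use weights in simp)
    then show "(2 * \<gamma> - \<omega>) * \<upsilon> * l p < 2 * (2 - \<omega>)"
      by (simp add: algebra_simps)
  next
    show "\<delta> k p = \<upsilon> *\<^sub>R (\<Sum>h\<in>H. N h p *\<^sub>R (case_prod Q h - (\<Sum>j\<in>I. N h j *\<^sub>R case_prod (fst (it k)) j)))" for k p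
      by (cases p) (auto simp: \<delta>_def mlspia_delta_def weighted surface intro!: sum.cong)
    show "case_prod (snd (it 0)) p = \<upsilon> *\<^sub>R (\<Sum>h\<in>H. N h p *\<^sub>R case_prod \<Lambda> h)" for p
      by (cases p) (simp add: it_def weighted)
  qed (use weights in \<open>auto simp: it_fst it_snd\<close>)
  then obtain L where lim: "\<And>i. i \<in> I \<Longrightarrow> (\<lambda>k. case_prod (fst (it k)) i) \<longlonglongrightarrow> L i"
    and normal: "\<And>i. i \<in> I \<Longrightarrow> (\<Sum>h\<in>H. N h i *\<^sub>R (case_prod Q h - (\<Sum>j\<in>I. N h j *\<^sub>R L j))) = 0"
    by blast
  have error: "fitting_error n1 \<phi> n2 \<psi> m1 t m2 s Q P =
      (\<Sum>h\<in>H. (norm (case_prod Q h - (\<Sum>j\<in>I. N h j *\<^sub>R case_prod P j)))\<^sup>2)" for P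
    unfolding fitting_error_def surface sum.cartesian_product H_def by (rule sum.cong) auto
  have "least_square_control_points n1 \<phi> n2 \<psi> m1 t m2 s Q (curry L)"
    unfolding least_square_control_points_def error
    using normal_equations_imp_least_squares[OF normal] by simp
  moreover have "(\<lambda>k. mlspia_points n1 \<phi> n2 \<psi> m1 t m2 s Q \<omega> \<gamma> \<upsilon> P0 \<Lambda> k i j) \<longlonglongrightarrow> curry L i j"
    if "i \<in> {1..n1}" "j \<in> {1..n2}" for i j
    using lim[of "(i, j)"] that unfolding I_def mlspia_points_def it_def by simp
  ultimately show ?thesis
    unfolding converges_to_least_square_surface_def by blast
qed

text \<open>It remains to see that \<open>\<sigma> 1 * \<mu> 1\<close> and \<open>\<sigma> r1 * \<mu> r2\<close> are positive bounds of the nonzero singular values of the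
  Kronecker product.\<close>

theorem theorem7:
  fixes m1 m2 n1 n2 r1 r2 :: nat
    and Q :: "nat \<Rightarrow> nat \<Rightarrow> real ^ 'd"
    and t s :: "nat \<Rightarrow> real"
    and \<phi> \<psi> :: "nat \<Rightarrow> real \<Rightarrow> real"
    and B1 B2 :: "real mat"
    and \<sigma> \<mu> :: "nat \<Rightarrow> real"
  assumes "m1 > n1" and "m2 > n2"
    and "increasing_params m1 t" and "increasing_params m2 s"
    and "NTP_basis n1 \<phi>" and "NTP_basis n2 \<psi>"
    and "B1 = collocation_mat \<phi> n1 t m1" and "B2 = collocation_mat \<psi> n2 s m2"
    and "vec_space.rank m1 B1 = r1" and "vec_space.rank m2 B2 = r2"
    and "map \<sigma> [1..<Suc r1] = nonzero_singular_values B1"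
    and "map \<mu> [1..<Suc r2] = nonzero_singular_values B2"
  shows "(\<forall>\<omega> \<gamma> \<upsilon> :: real.
            \<upsilon> > 0 \<and> 0 < \<omega> \<and> \<omega> < 2 \<and>
            \<omega> - \<omega> / ((\<sigma> 1 * \<mu> 1)\<^sup>2 * \<upsilon>) < \<gamma> \<and>
            \<gamma> < \<omega> / 2 - (\<omega> - 2) / ((\<sigma> 1 * \<mu> 1)\<^sup>2 * \<upsilon>) \<longrightarrow>
            (\<forall>P0 \<Lambda>. converges_to_least_square_surface n1 \<phi> n2 \<psi> m1 t m2 s Q
                      (mlspia_points n1 \<phi> n2 \<psi> m1 t m2 s Q \<omega> \<gamma> \<upsilon> P0 \<Lambda>))) \<and>
         (let a = \<sigma> 1 * \<mu> 1; b = \<sigma> r1 * \<mu> r2;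
              \<omega>' = 4 * a * b / (a + b)\<^sup>2; \<gamma>' = \<omega>'; \<upsilon>' = 1 / (a * b);
              \<rho> = convergence_rate (m1 * m2) (r1 * r2)
                    (Sigma_mat (r1 * r2) (kronecker_mat B1 B2)) \<omega>' \<gamma>' \<upsilon>'
          in \<rho> = (a - b) / (a + b) \<and>
             (a - b) / (a + b) \<le> (a\<^sup>2 - b\<^sup>2) / (a\<^sup>2 + b\<^sup>2) \<and>
             (a\<^sup>2 - b\<^sup>2) / (a\<^sup>2 + b\<^sup>2) < 1)"
proof -
  note B1_def = assms(7) and B2_def = assms(8)
  have B: "B1 \<in> carrier_mat m1 n1" "B2 \<in> carrier_mat m2 n2" unfolding B1_def B2_def by simp_all
  obtain U1 d1 U2 d2 where D1: "diagonalizes_gram B1 n1 U1 d1" and D2: "diagonalizes_gram B2 n2 U2 d2"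
    using diagonalizes_gram_exists[OF B(1)] diagonalizes_gram_exists[OF B(2)] by auto
  note bounds1 = descending_list_bounds[OF assms(11) sorted_nonzero_singular_values]
    and bounds2 = descending_list_bounds[OF assms(12) sorted_nonzero_singular_values]
  have nonempty: "nonzero_singular_values B1 \<noteq> []" "nonzero_singular_values B2 \<noteq> []"
    unfolding B1_def B2_def
    using assms(1-6) by (intro NTP_singular_values_nonempty; simp)+
  have len: "length (nonzero_singular_values B1) = r1" "length (nonzero_singular_values B2) = r2"
    using assms(11,12) by (metis diff_Suc_1 length_map length_upt)+
  have r: "0 < r1" "0 < r2" using nonempty len by auto
  have mem: "\<sigma> i \<in> set (nonzero_singular_values B1)" if "i \<in> {1..r1}" for i
    unfolding assms(11)[symmetric] using that by (auto simp: atLeastLessThanSuc_atLeastAtMost simp del: upt_Suc)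
  have mem': "\<mu> i \<in> set (nonzero_singular_values B2)" if "i \<in> {1..r2}" for i
    unfolding assms(12)[symmetric] using that by (auto simp: atLeastLessThanSuc_atLeastAtMost simp del: upt_Suc)
  have pos1: "0 < x" if "x \<in> set (nonzero_singular_values B1)" for x
    using that unfolding B1_def by (rule collocation_singular_values_pos)
  have pos2: "0 < x" if "x \<in> set (nonzero_singular_values B2)" for x
    using that unfolding B2_def by (rule collocation_singular_values_pos)
  define a b where "a = \<sigma> 1 * \<mu> 1" and "b = \<sigma> r1 * \<mu> r2"
  have \<sigma>: "0 < \<sigma> r1" "\<sigma> r1 \<le> \<sigma> 1" and \<mu>: "0 < \<mu> r2" "\<mu> r2 \<le> \<mu> 1"
    using r pos1 pos2 mem mem' bounds1(2) bounds2(2) by auto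
  have ab: "0 < b" "b \<le> a" unfolding a_def b_def using \<sigma> \<mu> by (auto intro!: mult_mono)
  have eig1: "d1 i \<le> (\<sigma> 1)\<^sup>2" "0 \<le> d1 i" if "i < n1" for i
  proof -
    show nonneg: "0 \<le> d1 i"
      using gram_eigenbasis_nonneg[OF gram_eigenbasis_collocation[OF D1[unfolded B1_def]], of "Suc i"] that by simp
    show "d1 i \<le> (\<sigma> 1)\<^sup>2"
    proof (cases "d1 i = 0")
      case False
      then have "sqrt (d1 i) \<le> \<sigma> 1"
        using that by (intro bounds1(2)) (auto simp: set_nonzero_singular_values[OF B(1) D1])
      then show ?thesis using nonneg by (metis real_sqrt_le_iff real_le_lsqrt sqrt_le_D)
    qed simp
  qed
  have eig2: "d2 i \<le> (\<mu> 1)\<^sup>2" "0 \<le> d2 i" if "i < n2" for i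
  proof -
    show nonneg: "0 \<le> d2 i"
      using gram_eigenbasis_nonneg[OF gram_eigenbasis_collocation[OF D2[unfolded B2_def]], of "Suc i"] that by simp
    show "d2 i \<le> (\<mu> 1)\<^sup>2"
    proof (cases "d2 i = 0")
      case False
      then have "sqrt (d2 i) \<le> \<mu> 1"
        using that by (intro bounds2(2)) (auto simp: set_nonzero_singular_values[OF B(2) D2])
      then show ?thesis using nonneg by (metis real_sqrt_le_iff real_le_lsqrt sqrt_le_D)
    qed simp
  qed
  have part1: "converges_to_least_square_surface n1 \<phi> n2 \<psi> m1 t m2 s Q
                 (mlspia_points n1 \<phi> n2 \<psi> m1 t m2 s Q \<omega> \<gamma> \<upsilon> P0 \<Lambda>)"
    if "\<upsilon> > 0" "0 < \<omega>" "\<omega> < 2" "\<omega> - \<omega> / (a\<^sup>2 * \<upsilon>) < \<gamma>" "\<gamma> < \<omega> / 2 - (\<omega> - 2) / (a\<^sup>2 * \<upsilon>)"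
    for \<omega> \<gamma> \<upsilon> P0 \<Lambda>
  proof (rule mlspia_surface_converges[OF D1[unfolded B1_def] D2[unfolded B2_def] _ _ that])
    show "d1 i * d2 j \<le> a\<^sup>2" if "i < n1" "j < n2" for i j
      unfolding a_def power_mult_distrib using eig1[OF that(1)] eig2[OF that(2)] by (intro mult_mono) auto
    show "a \<noteq> 0" using ab by simp
  qed
  have range: "nonzero_singular_values (kronecker_mat B1 B2) ! i \<in> {b..a}" if i: "i < r1 * r2" for i
  proof -
    have "nonzero_singular_values (kronecker_mat B1 B2) ! i \<in> set (nonzero_singular_values (kronecker_mat B1 B2))"
      using i len set_nonzero_singular_values_kronecker(2)[OF B] by (intro nth_mem) simp
    then obtain x y where xy: "nonzero_singular_values (kronecker_mat B1 B2) ! i = x * y"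
      "x \<in> set (nonzero_singular_values B1)" "y \<in> set (nonzero_singular_values B2)"
      using set_nonzero_singular_values_kronecker(1)[OF B] by blast
    show ?thesis
      unfolding xy(1) a_def b_def
      using bounds1[OF xy(2)] bounds2[OF xy(3)] pos1[OF xy(2)] pos2[OF xy(3)] \<sigma> \<mu>
      by (auto intro!: mult_mono)
  qed
  have rate: "convergence_rate (m1 * m2) (r1 * r2) (Sigma_mat (r1 * r2) (kronecker_mat B1 B2))
      (4 * a * b / (a + b)\<^sup>2) (4 * a * b / (a + b)\<^sup>2) (1 / (a * b)) = (a - b) / (a + b)"
    unfolding Sigma_mat_def
    by (rule H_hat_optimal_spectral_radius[OF _ ab]) (use r range in auto)
  have le: "(a - b) / (a + b) \<le> (a\<^sup>2 - b\<^sup>2) / (a\<^sup>2 + b\<^sup>2)"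
  proof -
    have "(a - b) / (a + b) = (a\<^sup>2 - b\<^sup>2) / (a + b)\<^sup>2"
      using ab by (simp add: power2_eq_square square_diff_square_factored)
    also have "\<dots> \<le> (a\<^sup>2 - b\<^sup>2) / (a\<^sup>2 + b\<^sup>2)"
      using ab by (intro divide_left_mono) (auto simp: power2_sum intro!: add_pos_pos mult_pos_pos power_mono)
    finally show ?thesis .
  qed
  have "(a\<^sup>2 - b\<^sup>2) / (a\<^sup>2 + b\<^sup>2) < 1"
    using ab by (simp add: divide_less_eq add_pos_pos)
  with rate le part1 show ?thesis
    unfolding Let_def a_def[symmetric] b_def[symmetric] by blast
qed

end
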